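(* Let $H:\mathbb{R}^N\to\mathbb{R}$ be a (differentiable) energy function with the equation $$\frac{du}{dt}=G\frac{\partial H}{\partial u},$$ where $u:t\in\mathbb{R}\mapsto u(t)\in\mathbb{R}^N$ and $G$ is a non-degenerate $N\times N$ real matrix. Suppose that the state space $K\subset\mathbb{R}^N$ of this system is compact and that the right-hand side $G\,\partial H/\partial u$ is Lipschitz continuous on $K$. If the activation function $\sigma\neq0$ belongs to $S^1_2(\mathbb{R})$, then for any $\varepsilon>0$ there exists a neural network $H_{\mathrm{NN}}:\mathbb{R}^N\to\mathbb{R}$ with activation function $\sigma$ for which $$\left\|G\frac{\partial H}{\partial u}-G\frac{\partial H_{\mathrm{NN}}}{\partial u}\right\|_{L^2(K)}<\varepsilon .$$ In addition, if $H$ is $C^\infty$ and the activation function is sufficiently smooth (i.e. $\sigma$ is moreover $C^\infty$), then $H_{\mathrm{NN}}$ can be taken to be a $C^\infty$ neural network.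
   Context: $\partial H/\partial u$ is the gradient of $H$ (a column vector); non-degenerate means invertible. For an integer $m\ge0$ and $1\le p\le\infty$, $W^{p,m}(X)$ is the Sobolev space of functions on $X$ having weak derivatives up to order $m$ in $L^p$, and $S^m_p(X)$ is $C^m(X)$ with the topology of $W^{p,m}(X)$, i.e. the space of functions in $W^{p,m}(X)$ with (usual) derivatives up to order $m$. In particular $\sigma\in S^1_2(\mathbb{R})$ means that $\sigma$ is $C^1$ with $\sigma,\sigma'\in L^2(\mathbb{R})$; $\sigma\neq0$ means that $\sigma$ is not identically zero. A neural network with activation function $\sigma$ is an element of $\Sigma(\sigma)$, the set of one-hidden-layer networks $x\mapsto\sum_{j=1}^q\beta_j\,\sigma(a_j\cdot x+b_j)$ with $q\in\mathbb{N}$, $\beta_j,b_j\in\mathbb{R}$, $a_j\in\mathbb{R}^N$. *)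

theory Defs
  imports "HOL-Analysis.Analysis"
begin

definition gradient :: "(real ^ 'n \<Rightarrow> real) \<Rightarrow> real ^ 'n \<Rightarrow> real ^ 'n" where
  "gradient f x = (\<chi> i. frechet_derivative f (at x) (axis i 1))"

lemma GDERIV_gradient:
  assumes "f differentiable (at x)"
  shows "GDERIV f x :> gradient f x"
proof -
  have d: "(f has_derivative frechet_derivative f (at x)) (at x)"
    using assms by (simp add: frechet_derivative_works)
  then have l: "linear (frechet_derivative f (at x))"
    by (rule has_derivative_linear)
  have "frechet_derivative f (at x) = (\<lambda>h. h \<bullet> gradient f x)"
  proof
    fix h :: "real ^ 'a"
    have "frechet_derivative f (at x) h
        = frechet_derivative f (at x) (\<Sum>i\<in>UNIV. h $ i *\<^sub>R axis i 1)"
      using basis_expansion[of h] by (simp add: scalar_mult_eq_scaleR)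
    also have "\<dots> = h \<bullet> gradient f x"
      by (simp add: linear_sum[OF l] linear_cmul[OF l] gradient_def inner_vec_def)
    finally show "frechet_derivative f (at x) h = h \<bullet> gradient f x" .
  qed
  with d show ?thesis by (simp add: gderiv_def)
qed

definition energy_rhs :: "real ^ 'n ^ 'n \<Rightarrow> (real ^ 'n \<Rightarrow> real) \<Rightarrow> real ^ 'n \<Rightarrow> real ^ 'n" where
  "energy_rhs G H u = G *v gradient H u"

definition in_L2 :: "'a::euclidean_space set \<Rightarrow> ('a \<Rightarrow> 'b::euclidean_space) \<Rightarrow> bool" where
  "in_L2 X f \<longleftrightarrow>
     set_borel_measurable lebesgue X f \<and> set_integrable lebesgue X (\<lambda>x. (norm (f x))\<^sup>2)"

text \<open>Meaningful only together with \<^const>\<open>in_L2\<close>, since the Bochner integral of a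
  non-integrable function is 0.\<close>

definition L2_norm :: "'a::euclidean_space set \<Rightarrow> ('a \<Rightarrow> 'b::euclidean_space) \<Rightarrow> real" where
  "L2_norm X f = sqrt (LINT x:X|lebesgue. (norm (f x))\<^sup>2)"

text \<open>The space $S^1_2$ over the real line. For a continuously differentiable function the weak
  derivative is the classical one, so no weak derivatives are needed.\<close>

definition S12 :: "(real \<Rightarrow> real) set" where
  "S12 = {\<sigma>. \<sigma> C1_differentiable_on UNIV \<and> in_L2 UNIV \<sigma> \<and> in_L2 UNIV (deriv \<sigma>)}"

primrec C_k :: "nat \<Rightarrow> ('a::real_normed_vector \<Rightarrow> 'b::real_normed_vector) \<Rightarrow> bool" where
  "C_k 0 f \<longleftrightarrow> continuous_on UNIV f"
| "C_k (Suc k) f \<longleftrightarrow>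
     (\<forall>x. f differentiable (at x)) \<and> (\<forall>v. C_k k (\<lambda>x. frechet_derivative f (at x) v))"

text \<open>Via directional derivatives of all orders, this is the usual notion on
  finite-dimensional domains, the only ones it is used for.\<close>

definition C_infinity :: "('a::euclidean_space \<Rightarrow> 'b::real_normed_vector) \<Rightarrow> bool" where
  "C_infinity f \<longleftrightarrow> (\<forall>k. C_k k f)"

definition neural_networks :: "(real \<Rightarrow> real) \<Rightarrow> (real ^ 'n \<Rightarrow> real) set" where
  "neural_networks \<sigma> =
     {f. \<exists>(q::nat) (\<beta> :: nat \<Rightarrow> real) (a :: nat \<Rightarrow> real ^ 'n) (b :: nat \<Rightarrow> real).
           f = (\<lambda>x. \<Sum>j<q. \<beta> j * \<sigma> (a j \<bullet> x + b j))}"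

end

theory Submission
  imports Defs
begin

text \<open>Put \<open>g = gradient H\<close>. As \<open>G\<close> is invertible, \<open>g\<close> is
continuous on the compact set \<open>K\<close>, and it is enough to approximate \<open>g\<close>
uniformly on \<open>K\<close> by gradients of networks: the mean square norm over a set of finite measure
is dominated by the uniform norm. The proof has two halves. They meet in the class
\<open>exp_jets\<close> of pairs (function, gradient) that are limits, locally uniformly in both
components, of linear combinations of \<open>x \<mapsto> exp (a \<bullet> x + b)\<close>.

The analytic half approximates \<open>g\<close> on \<open>K\<close>. Differentiability of
\<open>H\<close> at every point gives no uniform first order expansion on \<open>K\<close>, so
\<open>H\<close> itself cannot simply be discretised. It is replaced by a function \<open>V\<close> on
\<open>K\<close> that has such an expansion with the same \<open>g\<close>, up to an error \<open>c *
dist x y\<close> with \<open>c\<close> as small as desired (theorem \<open>uniform_potential\<close>).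
\<open>V\<close> is \<open>H\<close> plus a shortest path function: one runs through chains of points of
\<open>K\<close> with small steps, and a step from \<open>x\<close> to \<open>y\<close> costs the defect
\<open>(y - x) \<bullet> g x - (H y - H x)\<close> of the first order expansion plus \<open>c * dist x
y\<close>. The infimum over all chains is finite because chains of bounded length with small enough steps
have a total defect that is almost nonnegative (lemma \<open>short_chain_cost\<close>). Otherwise
repeated halving would produce, around a single point \<open>p\<close> of \<open>K\<close>, arbitrarily
short chains whose defect is at most \<open>- \<kappa>\<close> times their length, against the
differentiability of \<open>H\<close> at \<open>p\<close>. Once \<open>V\<close> is available, the affine
functions \<open>V y + g y \<bullet> (x - y)\<close> at the nodes \<open>y\<close> of a fine grid are
glued with tensor product quadratic B-splines. The gradients of the splines sum to zero, so only the
small errors of \<open>V\<close> get multiplied by the large slopes of the splines. The resulting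
function belongs to \<open>exp_jets\<close>, since that class is closed under products and contains every
continuously differentiable ridge function.

The algebraic half shows that every member of \<open>exp_jets\<close> is a limit of networks with
activation \<open>\<sigma>\<close>, again together with gradients. It suffices to reach
\<open>exp\<close> in one variable, and one reaches every monomial. If \<open>\<psi>\<close> is smooth
enough and approximable, then so is \<open>\<lambda>t. \<psi> (a * t + b)\<close>, and differentiating
\<open>k\<close> times in \<open>a\<close> at \<open>a = 0\<close> gives \<open>t ^ k\<close> times the
\<open>k\<close>-th derivative of \<open>\<psi>\<close> at \<open>b\<close>. Since
\<open>\<sigma>\<close> is only \<open>C\<^sup>1\<close>, take for \<open>\<psi>\<close> the
\<open>k\<close>-fold moving average of \<open>\<sigma>\<close> over intervals of length one: its
\<open>k\<close>-th derivative is the \<open>k\<close>-th forward difference of \<open>\<sigma>\<close>.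
That difference is not identically zero, because a function with zero forward difference is periodic, and
a nonzero continuous periodic function has infinite energy. The monomials yield all
\<open>C\<^sup>1\<close> functions by the Weierstrass theorem.

A network with a \<open>C\<^sup>\<infinity>\<close> activation is \<open>C\<^sup>\<infinity>\<close>, so
the second claim follows from the first.\<close>

section \<open>Closed spaces of one-dimensional jets\<close>

lemma uniform_in_parameter:
  fixes \<Theta> :: "real \<Rightarrow> 'a::euclidean_space \<Rightarrow> 'b::real_normed_vector"
  assumes "continuous_on UNIV (\<lambda>(s, x). \<Theta> s x)" "\<epsilon> > 0"
  obtains \<delta> where "\<delta> > 0"
    "\<And>s s' x. s \<in> {a..b} \<Longrightarrow> s' \<in> {a..b} \<Longrightarrow> \<bar>s' - s\<bar> < \<delta> \<Longrightarrow> x \<in> cball 0 R \<Longrightarrow> norm (\<Theta> s' x - \<Theta> s x) \<le> \<epsilon>"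
proof -
  have "uniformly_continuous_on ({a..b} \<times> cball 0 R) (\<lambda>(s, x). \<Theta> s x)"
    using assms(1) by (intro compact_uniformly_continuous compact_Times) (auto intro: continuous_on_subset)
  then obtain \<delta> where \<delta>: "\<delta> > 0" "\<And>z z'. z \<in> {a..b} \<times> cball 0 R \<Longrightarrow> z' \<in> {a..b} \<times> cball 0 R \<Longrightarrow>
     dist z' z < \<delta> \<Longrightarrow> dist ((\<lambda>(s, x). \<Theta> s x) z') ((\<lambda>(s, x). \<Theta> s x) z) < \<epsilon>"
    using assms(2) by (rule uniformly_continuous_onE) blast
  have "norm (\<Theta> s' x - \<Theta> s x) \<le> \<epsilon>" if "s \<in> {a..b}" "s' \<in> {a..b}" "\<bar>s' - s\<bar> < \<delta>" "x \<in> cball 0 R" for s s' x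
    using \<delta>(2)[of "(s, x)" "(s', x)"] that by (auto simp: dist_Pair_Pair dist_norm)
  with \<delta>(1) that show ?thesis by blast
qed

text \<open>The members are vector valued because they are used as jets, pairs of a function and its
derivative: convergence of jets is \<open>C\<^sup>1\<close> convergence, and no differentiability has to
be carried along. The condition \<open>closed\<close> is closedness for locally uniform
convergence.\<close>

locale closed_function_space =
  fixes S :: "('a::euclidean_space \<Rightarrow> 'b::euclidean_space) set"
  assumes zero: "(\<lambda>_. 0) \<in> S"
    and add: "f \<in> S \<Longrightarrow> h \<in> S \<Longrightarrow> (\<lambda>x. f x + h x) \<in> S"
    and scale: "f \<in> S \<Longrightarrow> (\<lambda>x. c *\<^sub>R f x) \<in> S"
    and closed: "(\<And>R \<epsilon>. \<epsilon> > 0 \<Longrightarrow> \<exists>p\<in>S. \<forall>x\<in>cball 0 R. norm (f x - p x) \<le> \<epsilon>) \<Longrightarrow> f \<in> S"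
begin

lemma diff: "f \<in> S \<Longrightarrow> h \<in> S \<Longrightarrow> (\<lambda>x. f x - h x) \<in> S"
  using add[OF _ scale[of h "-1"], of f] by simp

lemma sum: "(\<And>i. i \<in> I \<Longrightarrow> f i \<in> S) \<Longrightarrow> (\<lambda>x. \<Sum>i\<in>I. f i x) \<in> S"
  by (induction I rule: infinite_finite_induct) (auto intro: zero add)

text \<open>Difference quotients in the parameter converge locally uniformly, since the derivative is
uniformly continuous on compact sets. This is what makes monomials available.\<close>

lemma parameter_derivative:
  assumes mem: "\<And>s. \<Phi> s \<in> S"
    and deriv: "\<And>s x. ((\<lambda>s. \<Phi> s x) has_vector_derivative \<Theta> s x) (at s)"
    and cont: "continuous_on UNIV (\<lambda>(s, x). \<Theta> s x)"
  shows "\<Theta> s \<in> S"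
proof (rule closed)
  fix R \<epsilon> :: real assume "\<epsilon> > 0"
  obtain \<delta> where \<delta>: "\<delta> > 0" "\<And>r r' x. r \<in> {s..s + 1} \<Longrightarrow> r' \<in> {s..s + 1} \<Longrightarrow> \<bar>r' - r\<bar> < \<delta> \<Longrightarrow>
      x \<in> cball 0 R \<Longrightarrow> norm (\<Theta> r' x - \<Theta> r x) \<le> \<epsilon>"
    using uniform_in_parameter[OF cont \<open>\<epsilon> > 0\<close>] by blast
  define h where "h = min 1 (\<delta> / 2)"
  have h: "h > 0" "h \<le> 1" "h < \<delta>" using \<delta>(1) by (auto simp: h_def)
  show "\<exists>p\<in>S. \<forall>x\<in>cball 0 R. norm (\<Theta> s x - p x) \<le> \<epsilon>"
  proof (intro bexI ballI)
    show "(\<lambda>x. (1 / h) *\<^sub>R (\<Phi> (s + h) x - \<Phi> s x)) \<in> S" by (intro scale diff mem)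
    fix x :: 'a assume x: "x \<in> cball 0 R"
    have "norm (\<Phi> (s + h) x - \<Phi> s x - (s + h - s) *\<^sub>R \<Theta> s x) \<le> norm (s + h - s) * \<epsilon>"
    proof (rule vector_differentiable_bound_linearization[where S = "{s..s+h}"])
      show "norm (\<Theta> r x - \<Theta> s x) \<le> \<epsilon>" if "r \<in> {s..s + h}" for r
        using that h x by (intro \<delta>(2)) auto
    qed (use h deriv in \<open>auto intro: has_vector_derivative_at_within simp: closed_segment_eq_real_ivl\<close>)
    then have "norm (\<Phi> (s + h) x - \<Phi> s x - h *\<^sub>R \<Theta> s x) \<le> h * \<epsilon>" using h by simp
    moreover from h have "\<Theta> s x - (1 / h) *\<^sub>R (\<Phi> (s + h) x - \<Phi> s x)
        = (- 1 / h) *\<^sub>R (\<Phi> (s + h) x - \<Phi> s x - h *\<^sub>R \<Theta> s x)"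
      by (simp add: algebra_simps)
    then have "norm (\<Theta> s x - (1 / h) *\<^sub>R (\<Phi> (s + h) x - \<Phi> s x))
        = norm (\<Phi> (s + h) x - \<Phi> s x - h *\<^sub>R \<Theta> s x) / h"
      using h by simp
    ultimately show "norm (\<Theta> s x - (1 / h) *\<^sub>R (\<Phi> (s + h) x - \<Phi> s x)) \<le> \<epsilon>"
      using h by (simp add: pos_divide_le_eq mult.commute)
  qed
qed

text \<open>The difference \<open>\<Psi> 1 - \<Psi> 0\<close> is the integral of \<open>\<Phi>\<close>
over the parameter interval \<open>{0..1}\<close>, hence a locally uniform limit of Riemann sums. Stating
it through an antiderivative \<open>\<Psi>\<close> avoids vector valued integrals.\<close>

lemma parameter_integral:
  assumes mem: "\<And>s. \<Phi> s \<in> S"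
    and deriv: "\<And>s x. ((\<lambda>s. \<Psi> s x) has_vector_derivative \<Phi> s x) (at s)"
    and cont: "continuous_on UNIV (\<lambda>(s, x). \<Phi> s x)"
  shows "(\<lambda>x. \<Psi> 1 x - \<Psi> 0 x) \<in> S"
proof (rule closed)
  fix R \<epsilon> :: real assume "\<epsilon> > 0"
  obtain \<delta> where \<delta>: "\<delta> > 0" "\<And>r r' x. r \<in> {0..1} \<Longrightarrow> r' \<in> {0..1} \<Longrightarrow> \<bar>r' - r\<bar> < \<delta> \<Longrightarrow>
      x \<in> cball 0 R \<Longrightarrow> norm (\<Phi> r' x - \<Phi> r x) \<le> \<epsilon>"
    using uniform_in_parameter[OF cont \<open>\<epsilon> > 0\<close>] by blast
  obtain n :: nat where n: "n \<noteq> 0" "inverse (real n) < \<delta>" "0 < inverse (real n)"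
    using real_arch_inverse \<delta>(1) by blast
  define t where "t i = real i / real n" for i
  show "\<exists>p\<in>S. \<forall>x\<in>cball 0 R. norm (\<Psi> 1 x - \<Psi> 0 x - p x) \<le> \<epsilon>"
  proof (intro bexI ballI)
    show "(\<lambda>x. \<Sum>i<n. (1 / real n) *\<^sub>R \<Phi> (t i) x) \<in> S" by (intro sum scale mem)
    fix x :: 'a assume x: "x \<in> cball 0 R"
    have step: "norm (\<Psi> (t (Suc i)) x - \<Psi> (t i) x - (1 / real n) *\<^sub>R \<Phi> (t i) x) \<le> (1 / real n) * \<epsilon>" if "i < n" for i
    proof -
      have t: "0 \<le> t i" "t (Suc i) \<le> 1" "t (Suc i) - t i = 1 / real n" "t i \<le> t (Suc i)"
        using that n by (auto simp: t_def field_simps)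
      have "norm (\<Psi> (t (Suc i)) x - \<Psi> (t i) x - (t (Suc i) - t i) *\<^sub>R \<Phi> (t i) x) \<le> norm (t (Suc i) - t i) * \<epsilon>"
      proof (rule vector_differentiable_bound_linearization[where S = "{t i..t (Suc i)}"])
        show "norm (\<Phi> r x - \<Phi> (t i) x) \<le> \<epsilon>" if "r \<in> {t i..t (Suc i)}" for r
          using that t(1,2,4) x
        proof (intro \<delta>(2))
          have "\<bar>r - t i\<bar> \<le> t (Suc i) - t i" using that by auto
          also have "\<dots> < \<delta>" using n(2) t(3) by (simp add: inverse_eq_divide)
          finally show "\<bar>r - t i\<bar> < \<delta>" .
        qed auto
      qed (use t deriv in \<open>auto intro: has_vector_derivative_at_within simp: closed_segment_eq_real_ivl\<close>)
      then show ?thesis using t by simp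
    qed
    have "\<Psi> 1 x - \<Psi> 0 x = (\<Sum>i<n. \<Psi> (t (Suc i)) x - \<Psi> (t i) x)"
      using n by (subst sum_lessThan_telescope) (auto simp: t_def)
    then have "norm (\<Psi> 1 x - \<Psi> 0 x - (\<Sum>i<n. (1 / real n) *\<^sub>R \<Phi> (t i) x))
        = norm (\<Sum>i<n. \<Psi> (t (Suc i)) x - \<Psi> (t i) x - (1 / real n) *\<^sub>R \<Phi> (t i) x)"
      by (simp add: sum_subtractf)
    also have "\<dots> \<le> (\<Sum>i<n. (1 / real n) * \<epsilon>)" using step by (intro sum_norm_le) auto
    also have "\<dots> = \<epsilon>" using n by simp
    finally show "norm (\<Psi> 1 x - \<Psi> 0 x - (\<Sum>i<n. (1 / real n) *\<^sub>R \<Phi> (t i) x)) \<le> \<epsilon>" .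
  qed
qed

end

definition forward_difference :: "(real \<Rightarrow> real) \<Rightarrow> real \<Rightarrow> real" where
  "forward_difference f t = f (t + 1) - f t"

lemma DERIV_forward_difference:
  assumes "\<And>t. (f has_real_derivative f' t) (at t)"
  shows "(forward_difference f has_real_derivative forward_difference f' t) (at t)"
proof -
  have "((\<lambda>t. f (t + 1)) has_real_derivative f' (t + 1) * 1) (at t)"
    by (rule DERIV_chain2[OF assms]) (auto intro!: derivative_eq_intros)
  from DERIV_diff[OF this assms] show ?thesis unfolding forward_difference_def by simp
qed

lemma continuous_forward_difference:
  assumes "continuous_on UNIV f"
  shows "continuous_on UNIV (forward_difference f)"
  unfolding forward_difference_def
  by (intro continuous_intros continuous_on_compose2[OF assms]) auto

text \<open>What is retained from square integrability: it passes to forward differences, and it excludes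
nonzero periodic functions.\<close>

definition bounded_energy :: "(real \<Rightarrow> real) \<Rightarrow> bool" where
  "bounded_energy f \<longleftrightarrow> continuous_on UNIV f \<and> (\<exists>B. \<forall>a b. integral {a..b} (\<lambda>t. (f t)\<^sup>2) \<le> B)"

lemma bounded_energy_forward_difference:
  assumes "bounded_energy f"
  shows "bounded_energy (forward_difference f)"
proof -
  obtain B where B: "\<And>a b. integral {a..b} (\<lambda>t. (f t)\<^sup>2) \<le> B" and f: "continuous_on UNIV f"
    using assms unfolding bounded_energy_def by blast
  have c: "continuous_on X f" "continuous_on X (\<lambda>t. f (1 + t))" "continuous_on X (\<lambda>t. f (t + 1))" for X
    by (intro continuous_on_compose2[OF f] continuous_intros; auto)+
  have "integral {a..b} (\<lambda>t. (forward_difference f t)\<^sup>2) \<le> 4 * B" for a b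
  proof -
    have "integral {a..b} (\<lambda>t. (forward_difference f t)\<^sup>2)
        \<le> integral {a..b} (\<lambda>t. 2 * (f (1 + t))\<^sup>2 + 2 * (f t)\<^sup>2)"
    proof (rule integral_le)
      fix t
      (* (u - v)^2 + (u + v)^2 = 2 * u^2 + 2 * v^2 *)
      have "0 \<le> (f (1 + t) + f t)\<^sup>2" by simp
      then show "(forward_difference f t)\<^sup>2 \<le> 2 * (f (1 + t))\<^sup>2 + 2 * (f t)\<^sup>2"
        by (simp add: forward_difference_def power2_eq_square algebra_simps)
    qed (auto simp: forward_difference_def intro!: integrable_continuous_interval continuous_intros c)
    also have "\<dots> = 2 * integral {a..b} (\<lambda>t. (f (1 + t))\<^sup>2) + 2 * integral {a..b} (\<lambda>t. (f t)\<^sup>2)"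
      by (subst integral_add) (auto intro!: integrable_continuous_interval continuous_intros c)
    also have "integral {a..b} (\<lambda>t. (f (1 + t))\<^sup>2) = integral {a + 1..b + 1} (\<lambda>t. (f t)\<^sup>2)"
      using integral_shift_Icc_real[of a b "\<lambda>t. (f t)\<^sup>2" 1] by (simp add: o_def)
    finally show ?thesis using B[of a b] B[of "a + 1" "b + 1"] by simp
  qed
  then show ?thesis
    unfolding bounded_energy_def using continuous_forward_difference[OF f] by blast
qed

text \<open>If the forward difference vanished, \<open>f\<close> would have period one, and the energy
over \<open>n\<close> periods would be \<open>n\<close> times a positive number.\<close>

lemma forward_difference_nonzero:
  assumes "bounded_energy f" "f \<noteq> (\<lambda>_. 0)"
  shows "forward_difference f \<noteq> (\<lambda>_. 0)"
proof
  assume "forward_difference f = (\<lambda>_. 0)"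
  then have per: "f (t + 1) = f t" for t by (metis eq_iff_diff_eq_0 forward_difference_def)
  obtain t0 where t0: "f t0 \<noteq> 0" using assms(2) by auto
  obtain B where B: "\<And>a b. integral {a..b} (\<lambda>t. (f t)\<^sup>2) \<le> B" and f: "continuous_on UNIV f"
    using assms unfolding bounded_energy_def by blast
  have c: "continuous_on X (\<lambda>t. (f t)\<^sup>2)" for X
    by (intro continuous_intros continuous_on_subset[OF f]) auto
  define I where "I = integral {t0..t0 + 1} (\<lambda>t. (f t)\<^sup>2)"
  have "I \<noteq> 0"
    unfolding I_def using t0 by (subst integral_eq_0_iff[OF c]) auto
  moreover have "I \<ge> 0" unfolding I_def by (intro integral_nonneg integrable_continuous_interval c) auto
  ultimately have I: "I > 0" by simp
  have shift: "integral {a + 1..b + 1} (\<lambda>t. (f t)\<^sup>2) = integral {a..b} (\<lambda>t. (f t)\<^sup>2)" for a b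
    using integral_shift_Icc_real[of a b "\<lambda>t. (f t)\<^sup>2" 1] per by (simp add: o_def add.commute)
  have "integral {t0..t0 + real n} (\<lambda>t. (f t)\<^sup>2) = real n * I" for n
  proof (induction n)
    case (Suc n)
    have "integral {t0..t0 + real (Suc n)} (\<lambda>t. (f t)\<^sup>2)
       = integral {t0..t0 + 1} (\<lambda>t. (f t)\<^sup>2) + integral {t0 + 1..t0 + real n + 1} (\<lambda>t. (f t)\<^sup>2)"
      using Henstock_Kurzweil_Integration.integral_combine[of t0 "t0 + 1" "t0 + real (Suc n)" "\<lambda>t. (f t)\<^sup>2"]
        integrable_continuous_interval[OF c] by (simp add: ac_simps)
    then show ?case using Suc shift[of t0 "t0 + real n"] by (simp add: I_def algebra_simps)
  qed simp
  then have "real n * I \<le> B" for n using B by metis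
  moreover obtain n where "B < real n * I" using reals_Archimedean3[OF I] by blast
  ultimately show False by (meson not_le)
qed

lemma derivative_tower_continuous:
  fixes \<psi> :: "nat \<Rightarrow> real \<Rightarrow> real"
  assumes "\<And>j t. j \<le> k \<Longrightarrow> (\<psi> j has_real_derivative \<psi> (Suc j) t) (at t)"
    and "continuous_on UNIV (\<psi> (Suc k))" "j \<le> Suc k"
  shows "continuous_on UNIV (\<psi> j)"
proof (cases "j = Suc k")
  case False
  then have "isCont (\<psi> j) t" for t using assms(3) by (intro DERIV_isCont[OF assms(1)]) simp
  then show ?thesis by (simp add: continuous_on_eq_continuous_at)
qed (use assms(2) in simp)

text \<open>Jets \<open>(f, f')\<close> in one variable. The condition \<open>affine\<close> is the chain
rule for \<open>t \<mapsto> f (a * t + b)\<close>.\<close>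

locale affine_jet_space = closed_function_space S for S :: "(real \<Rightarrow> real \<times> real) set" +
  assumes affine: "\<phi> \<in> S \<Longrightarrow> (\<lambda>t. (fst (\<phi> (a * t + b)), a * snd (\<phi> (a * t + b)))) \<in> S"
begin

text \<open>Averaging over an interval of length one turns \<open>\<psi>\<close> into \<open>F (t + 1) -
F t\<close> with an antiderivative \<open>F\<close> of \<open>\<psi>\<close>, which gains one derivative.
After \<open>k\<close> rounds the \<open>k\<close>-th derivative is the \<open>k\<close>-th forward
difference of the original function. The sequence \<open>\<psi>\<close> lists the smoothed function and
its derivatives.\<close>

lemma smoothing:
  assumes "(\<lambda>t. (f t, f' t)) \<in> S" "\<And>t. (f has_real_derivative f' t) (at t)" "continuous_on UNIV f'"
  shows "\<exists>\<psi>. (\<lambda>t. (\<psi> 0 t, \<psi> (Suc 0) t)) \<in> S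
    \<and> (\<forall>j\<le>k. \<forall>t. (\<psi> j has_real_derivative \<psi> (Suc j) t) (at t))
    \<and> continuous_on UNIV (\<psi> (Suc k)) \<and> \<psi> k = (forward_difference ^^ k) f"
proof (induction k)
  case 0
  show ?case
    by (rule exI[of _ "\<lambda>j. if j = 0 then f else f'"]) (use assms in auto)
next
  case (Suc k)
  then obtain \<psi> where \<psi>: "(\<lambda>t. (\<psi> 0 t, \<psi> (Suc 0) t)) \<in> S"
    "\<And>j t. j \<le> k \<Longrightarrow> (\<psi> j has_real_derivative \<psi> (Suc j) t) (at t)"
    "continuous_on UNIV (\<psi> (Suc k))" "\<psi> k = (forward_difference ^^ k) f" by blast
  have cont: "continuous_on UNIV (\<psi> j)" if "j \<le> Suc k" for j
    using derivative_tower_continuous[of k \<psi> j] \<psi>(2) \<psi>(3) that by blast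
  have "\<forall>x. isCont (\<psi> 0) x" using cont[of 0] by (simp add: continuous_on_eq_continuous_at)
  then obtain F where F: "\<And>t. (F has_real_derivative \<psi> 0 t) (at t)"
    using einterval_antiderivative[of "-\<infinity>" "\<infinity>" "\<psi> 0"]
    by (auto simp: has_real_derivative_iff_has_vector_derivative)
  define \<psi>' where "\<psi>' = case_nat (forward_difference F) (\<lambda>j. forward_difference (\<psi> j))"
  have "(\<lambda>t. (F (t + 1), \<psi> 0 (t + 1)) - (F (t + 0), \<psi> 0 (t + 0))) \<in> S"
  proof (rule parameter_integral[where \<Phi> = "\<lambda>s t. (\<psi> 0 (t + s), \<psi> (Suc 0) (t + s))"])
    show "(\<lambda>t. (\<psi> 0 (t + s), \<psi> (Suc 0) (t + s))) \<in> S" for s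
      using affine[OF \<psi>(1), of 1 s] by simp
    have sh: "((\<lambda>s. h (t + s)) has_vector_derivative h' (t + s)) (at s)"
      if "\<And>t. (h has_real_derivative h' t) (at t)" for h h' t s
    proof -
      have "((\<lambda>s. h (t + s)) has_real_derivative h' (t + s) * 1) (at s)"
        by (rule DERIV_chain2[OF that]) (auto intro!: derivative_eq_intros)
      then show ?thesis by (simp add: has_real_derivative_iff_has_vector_derivative)
    qed
    show "((\<lambda>s. (F (t + s), \<psi> 0 (t + s))) has_vector_derivative (\<psi> 0 (t + s), \<psi> (Suc 0) (t + s))) (at s)" for s t
      by (intro has_vector_derivative_Pair sh F \<psi>(2)) simp
    show "continuous_on UNIV (\<lambda>(s, t). (\<psi> 0 (t + s), \<psi> (Suc 0) (t + s)))"
      unfolding case_prod_unfold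
      by (intro continuous_intros continuous_on_compose2[OF cont[of 0]] continuous_on_compose2[OF cont[of "Suc 0"]]) auto
  qed
  then have "(\<lambda>t. (\<psi>' 0 t, \<psi>' (Suc 0) t)) \<in> S"
    by (simp add: \<psi>'_def forward_difference_def)
  moreover have "(\<psi>' j has_real_derivative \<psi>' (Suc j) t) (at t)" if "j \<le> Suc k" for j t
  proof (cases j)
    case 0
    then show ?thesis using DERIV_forward_difference[OF F] by (simp add: \<psi>'_def)
  next
    case (Suc i)
    then show ?thesis using DERIV_forward_difference[OF \<psi>(2)] that by (simp add: \<psi>'_def)
  qed
  moreover have "continuous_on UNIV (\<psi>' (Suc (Suc k)))"
    using continuous_forward_difference[OF \<psi>(3)] by (simp add: \<psi>'_def)
  moreover have "\<psi>' (Suc k) = (forward_difference ^^ Suc k) f" using \<psi>(4) by (simp add: \<psi>'_def)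
  ultimately show ?case by blast
qed

text \<open>The \<open>j\<close>-th derivative of \<open>\<psi> 0 (a * t + b)\<close> in \<open>a\<close>
is \<open>t ^ j * \<psi> j (a * t + b)\<close>; at \<open>a = 0\<close> and \<open>j = k\<close> the
second factor is a nonzero constant.\<close>

lemma monomial_mem:
  assumes mem: "(\<lambda>t. (\<psi> 0 t, \<psi> (Suc 0) t)) \<in> S"
    and deriv: "\<And>j t. j \<le> k \<Longrightarrow> (\<psi> j has_real_derivative \<psi> (Suc j) t) (at t)"
    and contk: "continuous_on UNIV (\<psi> (Suc k))"
    and nz: "\<psi> k b \<noteq> 0"
  shows "(\<lambda>t. (t ^ k, real k * t ^ (k - 1))) \<in> S"
proof -
  have cont: "continuous_on UNIV (\<psi> j)" if "j \<le> Suc k" for j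
    using derivative_tower_continuous[of k \<psi> j] deriv contk that by blast
  have "(\<lambda>t. (t ^ j * \<psi> j (a * t + b), real j * t ^ (j - 1) * \<psi> j (a * t + b) + a * t ^ j * \<psi> (Suc j) (a * t + b))) \<in> S"
    if "j \<le> k" for j a
    using that
  proof (induction j arbitrary: a)
    case 0
    then show ?case using affine[OF mem, of a b] by simp
  next
    case (Suc j)
    have d: "((\<lambda>a. \<psi> i (a * t + b)) has_real_derivative \<psi> (Suc i) (a * t + b) * t) (at a)" if "i \<le> k" for i t a
    proof -
      have "((\<lambda>a. a * t + b) has_real_derivative t) (at a)" by (auto intro!: derivative_eq_intros)
      from DERIV_chain2[OF deriv[OF that] this] show ?thesis .
    qed
    define \<Phi> where "\<Phi> a t = (t ^ j * \<psi> j (a * t + b),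
        real j * t ^ (j - 1) * \<psi> j (a * t + b) + a * t ^ j * \<psi> (Suc j) (a * t + b))" for a t
    define \<Theta> where "\<Theta> a t = (t ^ j * (\<psi> (Suc j) (a * t + b) * t),
        real j * t ^ (j - 1) * (\<psi> (Suc j) (a * t + b) * t)
          + (t ^ j * \<psi> (Suc j) (a * t + b) + a * t ^ j * (\<psi> (Suc (Suc j)) (a * t + b) * t)))" for a t
    have "\<Theta> a \<in> S"
    proof (rule parameter_derivative[of \<Phi> \<Theta>])
      show "\<Phi> a \<in> S" for a
        unfolding \<Phi>_def using Suc.prems by (intro Suc.IH) simp
      show "((\<lambda>a. \<Phi> a t) has_vector_derivative \<Theta> a t) (at a)" for a t
      proof -
        have 1: "((\<lambda>a. t ^ j * \<psi> j (a * t + b)) has_real_derivative t ^ j * (\<psi> (Suc j) (a * t + b) * t)) (at a)"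
          using Suc.prems by (intro DERIV_cmult d) simp
        have 2: "((\<lambda>a. real j * t ^ (j - 1) * \<psi> j (a * t + b)) has_real_derivative
            real j * t ^ (j - 1) * (\<psi> (Suc j) (a * t + b) * t)) (at a)"
          using Suc.prems by (intro DERIV_cmult d) simp
        have 3: "((\<lambda>a. a * t ^ j * \<psi> (Suc j) (a * t + b)) has_real_derivative
            t ^ j * \<psi> (Suc j) (a * t + b) + a * t ^ j * (\<psi> (Suc (Suc j)) (a * t + b) * t)) (at a)"
          using DERIV_mult'[OF DERIV_cmult_right[OF DERIV_ident, of "t ^ j"] d[OF Suc.prems, of t a]] by (simp add: ac_simps)
        show ?thesis
          unfolding \<Phi>_def \<Theta>_def
          using has_vector_derivative_Pair[OF 1[unfolded has_real_derivative_iff_has_vector_derivative]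
              DERIV_add[OF 2 3, unfolded has_real_derivative_iff_has_vector_derivative]] .
      qed
      have c: "continuous_on UNIV (\<lambda>z::real \<times> real. \<psi> i (fst z * snd z + b))" if "i \<le> Suc k" for i
        by (intro continuous_on_compose2[OF cont[OF that]] continuous_intros) auto
      show "continuous_on UNIV (\<lambda>(a, t). \<Theta> a t)"
        unfolding case_prod_unfold \<Theta>_def using Suc.prems by (intro continuous_intros c) auto
    qed
    moreover have "\<Theta> a = (\<lambda>t. (t ^ Suc j * \<psi> (Suc j) (a * t + b),
        real (Suc j) * t ^ (Suc j - 1) * \<psi> (Suc j) (a * t + b) + a * t ^ Suc j * \<psi> (Suc (Suc j)) (a * t + b)))"
      unfolding \<Theta>_def by (cases j) (auto simp: algebra_simps)
    ultimately show ?case by (simp only:)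
  qed
  (* at a = 0 the factor depending on psi is constant and can be divided out *)
  from scale[OF this[of k 0], of "1 / \<psi> k b"] nz show ?thesis by simp
qed

text \<open>Approximate the derivative by a polynomial and integrate: this controls the function together
with its derivative.\<close>

lemma all_C1_mem:
  assumes mon: "\<And>k. (\<lambda>t. (t ^ k, real k * t ^ (k - 1))) \<in> S"
    and deriv: "\<And>t. (f has_real_derivative f' t) (at t)"
    and cont: "continuous_on UNIV f'"
  shows "(\<lambda>t. (f t, f' t)) \<in> S"
proof (rule closed)
  fix R0 \<epsilon> :: real assume "\<epsilon> > 0"
  define R where "R = max R0 0"
  have "\<epsilon> / (R + 1) > 0" using \<open>\<epsilon> > 0\<close> by (simp add: R_def add_nonneg_pos)
  then obtain p where "real_polynomial_function p" and p: "\<And>t. t \<in> {-R..R} \<Longrightarrow> \<bar>f' t - p t\<bar> < \<epsilon> / (R + 1)"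
    using Stone_Weierstrass_real_polynomial_function[of "{-R..R}" f' "\<epsilon> / (R + 1)"] continuous_on_subset[OF cont] by auto
  then obtain a n where a: "p = (\<lambda>t. \<Sum>i\<le>n. a i * t ^ i)"
    unfolding real_polynomial_function_iff_sum by blast
  define q where "q t = f 0 + (\<Sum>i\<le>n. a i / real (Suc i) * t ^ Suc i)" for t
  have q': "(q has_real_derivative p t) (at t)" for t
  proof -
    have "((\<lambda>t. a i / real (Suc i) * t ^ Suc i) has_real_derivative a i / real (Suc i) * (real (Suc i) * t ^ i)) (at t)" for i
      using DERIV_pow[of "Suc i" t] by (intro DERIV_cmult) simp
    then have "((\<lambda>t. a i / real (Suc i) * t ^ Suc i) has_real_derivative a i * t ^ i) (at t)" for i
      by simp
    then have "((\<lambda>t. f 0 + (\<Sum>i\<le>n. a i / real (Suc i) * t ^ Suc i)) has_real_derivative 0 + (\<Sum>i\<le>n. a i * t ^ i)) (at t)"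
      by (intro DERIV_add DERIV_const DERIV_sum)
    then show ?thesis unfolding q_def a by simp
  qed
  show "\<exists>\<phi>\<in>S. \<forall>t\<in>cball 0 R0. norm ((f t, f' t) - \<phi> t) \<le> \<epsilon>"
  proof (intro bexI ballI)
    have "(\<lambda>t. f 0 *\<^sub>R (t ^ 0, real 0 * t ^ (0 - 1)) + (\<Sum>i\<le>n. (a i / real (Suc i)) *\<^sub>R (t ^ Suc i, real (Suc i) * t ^ (Suc i - 1)))) \<in> S"
      by (intro add sum scale mon)
    moreover have "f 0 *\<^sub>R (t ^ 0, real 0 * t ^ (0 - 1)) + (\<Sum>i\<le>n. (a i / real (Suc i)) *\<^sub>R (t ^ Suc i, real (Suc i) * t ^ (Suc i - 1))) = (q t, p t)" for t
      by (simp add: q_def a prod_eq_iff fst_sum snd_sum del: of_nat_Suc power_Suc)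
    ultimately show "(\<lambda>t. (q t, p t)) \<in> S" by simp
  next
    fix t :: real assume "t \<in> cball 0 R0"
    then have t: "t \<in> {-R..R}" "\<bar>t\<bar> \<le> R" by (auto simp: R_def)
    have R: "R \<ge> 0" by (simp add: R_def)
    have "norm ((f t - q t) - (f 0 - q 0)) \<le> \<epsilon> / (R + 1) * norm (t - 0)"
    proof (rule field_differentiable_bound[where S = "{-R..R}" and f' = "\<lambda>t. f' t - p t"])
      show "((\<lambda>t. f t - q t) has_real_derivative f' z - p z) (at z within {- R..R})" for z
        using deriv q' by (intro DERIV_diff) (auto intro: has_field_derivative_at_within)
      show "norm (f' z - p z) \<le> \<epsilon> / (R + 1)" if "z \<in> {-R..R}" for z
        using p[OF that] by simp
    qed (use t R in auto)
    also have "\<dots> \<le> \<epsilon> / (R + 1) * R" using t \<open>\<epsilon> / (R + 1) > 0\<close> by (intro mult_left_mono) auto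
    finally have "\<bar>f t - q t\<bar> \<le> \<epsilon> / (R + 1) * R" by (simp add: q_def)
    moreover have "\<bar>f' t - p t\<bar> \<le> \<epsilon> / (R + 1)" using p[OF t(1)] by simp
    moreover have "\<epsilon> / (R + 1) * (R + 1) = \<epsilon>" using R by simp
    then have "\<epsilon> / (R + 1) * R + \<epsilon> / (R + 1) = \<epsilon>" by (simp only: distrib_left mult_1_right)
    ultimately show "norm ((f t, f' t) - (q t, p t)) \<le> \<epsilon>"
      using norm_Pair_le[of "f t - q t" "f' t - p t"] by simp
  qed
qed

theorem all_C1_of_activation:
  assumes "(\<lambda>t. (\<sigma> t, \<sigma>' t)) \<in> S" "\<And>t. (\<sigma> has_real_derivative \<sigma>' t) (at t)" "continuous_on UNIV \<sigma>'"
    and "bounded_energy \<sigma>" "\<sigma> \<noteq> (\<lambda>_. 0)"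
    and "\<And>t. (f has_real_derivative f' t) (at t)" "continuous_on UNIV f'"
  shows "(\<lambda>t. (f t, f' t)) \<in> S"
proof (rule all_C1_mem)
  fix k
  have "bounded_energy ((forward_difference ^^ k) \<sigma>) \<and> (forward_difference ^^ k) \<sigma> \<noteq> (\<lambda>_. 0)"
    by (induction k) (use assms(4,5) bounded_energy_forward_difference forward_difference_nonzero in auto)
  then obtain b where "(forward_difference ^^ k) \<sigma> b \<noteq> 0" by auto
  then show "(\<lambda>t. (t ^ k, real k * t ^ (k - 1))) \<in> S"
    using smoothing[OF assms(1-3), of k] monomial_mem[of _ k b] by metis
qed (use assms in auto)

theorem all_C1_of_exp:
  assumes "(\<lambda>t. (exp t, exp t)) \<in> S"
    and "\<And>t. (f has_real_derivative f' t) (at t)" "continuous_on UNIV f'"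
  shows "(\<lambda>t. (f t, f' t)) \<in> S"
proof (rule all_C1_mem)
  show "(\<lambda>t. (t ^ k, real k * t ^ (k - 1))) \<in> S" for k
    using assms(1) by (intro monomial_mem[of "\<lambda>_. exp" k 0]) (auto intro: continuous_intros)
qed (use assms in auto)

end

section \<open>Ridge jets and the algebra generated by exponentials\<close>

definition lu_closure :: "('a::euclidean_space \<Rightarrow> 'b::euclidean_space) set \<Rightarrow> ('a \<Rightarrow> 'b) set" where
  "lu_closure S = {f. \<forall>R. \<forall>\<epsilon>>0. \<exists>p\<in>S. \<forall>x\<in>cball 0 R. norm (f x - p x) \<le> \<epsilon>}"

lemma lu_closureD:
  assumes "f \<in> lu_closure S" "\<epsilon> > 0"
  obtains p where "p \<in> S" "\<And>x. x \<in> cball 0 R \<Longrightarrow> norm (f x - p x) \<le> \<epsilon>"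
  using assms unfolding lu_closure_def by blast

text \<open>Linear hull of a set of functions, generated one summand at a time, in the way a network
grows neuron by neuron.\<close>

inductive_set fspan :: "('a \<Rightarrow> 'b::real_vector) set \<Rightarrow> ('a \<Rightarrow> 'b) set" for B where
  fspan_zero: "(\<lambda>_. 0) \<in> fspan B"
| fspan_step: "f \<in> fspan B \<Longrightarrow> h \<in> B \<Longrightarrow> (\<lambda>x. f x + c *\<^sub>R h x) \<in> fspan B"

lemma fspan_base: "h \<in> B \<Longrightarrow> h \<in> fspan B"
  using fspan_step[OF fspan_zero, of h B 1] by simp

lemma fspan_add:
  assumes "f \<in> fspan B" "h \<in> fspan B"
  shows "(\<lambda>x. f x + h x) \<in> fspan B"
  using assms(2)
proof (induction rule: fspan.induct)
  case (fspan_step h' h c)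
  from fspan.fspan_step[OF fspan_step.IH fspan_step.hyps(2), of c] show ?case by (simp add: add.assoc)
qed (use assms(1) in simp)

lemma fspan_scale:
  assumes "f \<in> fspan B"
  shows "(\<lambda>x. c *\<^sub>R f x) \<in> fspan B"
  using assms
proof (induction rule: fspan.induct)
  case (fspan_step h' h d)
  from fspan.fspan_step[OF fspan_step.IH fspan_step.hyps(2), of "c * d"] show ?case
    by (simp add: scaleR_right_distrib)
qed (simp add: fspan_zero)

lemma subset_lu_closure: "S \<subseteq> lu_closure S"
  unfolding lu_closure_def by force

lemma closed_function_space_lu_closure: "closed_function_space (lu_closure (fspan B))"
proof
  show "(\<lambda>_. 0) \<in> lu_closure (fspan B)" using subset_lu_closure fspan_zero by blast
next
  fix f h assume fh: "f \<in> lu_closure (fspan B)" "h \<in> lu_closure (fspan B)"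
  show "(\<lambda>x. f x + h x) \<in> lu_closure (fspan B)"
    unfolding lu_closure_def
  proof (intro CollectI allI impI)
    fix R \<epsilon> :: real assume "\<epsilon> > 0"
    then have e: "\<epsilon> / 2 > 0" by simp
    obtain p where p: "p \<in> fspan B" "\<And>x. x \<in> cball 0 R \<Longrightarrow> norm (f x - p x) \<le> \<epsilon> / 2"
      using lu_closureD[OF fh(1) e] by blast
    obtain q where q: "q \<in> fspan B" "\<And>x. x \<in> cball 0 R \<Longrightarrow> norm (h x - q x) \<le> \<epsilon> / 2"
      using lu_closureD[OF fh(2) e] by blast
    have "norm (f x + h x - (p x + q x)) \<le> \<epsilon>" if "x \<in> cball 0 R" for x
    proof -
      have "norm (f x + h x - (p x + q x)) \<le> norm (f x - p x) + norm (h x - q x)" by (rule norm_diff_triangle_ineq)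
      also have "\<dots> \<le> \<epsilon>" using p(2)[OF that] q(2)[OF that] by simp
      finally show ?thesis .
    qed
    then show "\<exists>p\<in>fspan B. \<forall>x\<in>cball 0 R. norm (f x + h x - p x) \<le> \<epsilon>"
      by (intro bexI[OF _ fspan_add[OF p(1) q(1)]]) simp
  qed
next
  fix f and c :: real assume f: "f \<in> lu_closure (fspan B)"
  show "(\<lambda>x. c *\<^sub>R f x) \<in> lu_closure (fspan B)"
    unfolding lu_closure_def
  proof (intro CollectI allI impI)
    fix R \<epsilon> :: real assume e: "\<epsilon> > 0"
    then have "\<epsilon> / (\<bar>c\<bar> + 1) > 0" by simp
    then obtain p where p: "p \<in> fspan B" "\<And>x. x \<in> cball 0 R \<Longrightarrow> norm (f x - p x) \<le> \<epsilon> / (\<bar>c\<bar> + 1)"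
      using lu_closureD[OF f] by blast
    have "norm (c *\<^sub>R f x - c *\<^sub>R p x) \<le> \<epsilon>" if "x \<in> cball 0 R" for x
    proof -
      have "norm (c *\<^sub>R f x - c *\<^sub>R p x) = \<bar>c\<bar> * norm (f x - p x)" by (simp flip: scaleR_diff_right)
      also have "\<dots> \<le> (\<bar>c\<bar> + 1) * (\<epsilon> / (\<bar>c\<bar> + 1))" using p(2)[OF that] by (intro mult_mono) auto
      finally show ?thesis by simp
    qed
    then show "\<exists>p\<in>fspan B. \<forall>x\<in>cball 0 R. norm (c *\<^sub>R f x - p x) \<le> \<epsilon>"
      by (intro bexI[OF _ fspan_scale[OF p(1), of c]]) auto
  qed
next
  fix f assume f: "\<And>R \<epsilon>. \<epsilon> > 0 \<Longrightarrow> \<exists>p\<in>lu_closure (fspan B). \<forall>x\<in>cball 0 R. norm (f x - p x) \<le> \<epsilon>"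
  show "f \<in> lu_closure (fspan B)"
    unfolding lu_closure_def
  proof (intro CollectI allI impI)
    fix R \<epsilon> :: real assume "\<epsilon> > 0"
    then have e: "\<epsilon> / 2 > 0" by simp
    obtain p where p: "p \<in> lu_closure (fspan B)" "\<And>x. x \<in> cball 0 R \<Longrightarrow> norm (f x - p x) \<le> \<epsilon> / 2"
      using f[OF e] by blast
    obtain q where q: "q \<in> fspan B" "\<And>x. x \<in> cball 0 R \<Longrightarrow> norm (p x - q x) \<le> \<epsilon> / 2"
      using lu_closureD[OF p(1) e] by blast
    have "norm (f x - q x) \<le> \<epsilon>" if "x \<in> cball 0 R" for x
      using p(2)[OF that] q(2)[OF that] norm_diff_triangle_le[of "f x" "p x" "\<epsilon> / 2" "q x" "\<epsilon> / 2"] by simp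
    then show "\<exists>p\<in>fspan B. \<forall>x\<in>cball 0 R. norm (f x - p x) \<le> \<epsilon>" using q(1) by blast
  qed
qed

lemma (in closed_function_space) lu_closure_fspan_subset:
  assumes "B \<subseteq> S"
  shows "lu_closure (fspan B) \<subseteq> S"
proof
  have span: "p \<in> S" if "p \<in> fspan B" for p
    using that by (induction rule: fspan.induct) (use assms in \<open>auto intro!: zero add scale\<close>)
  fix f assume "f \<in> lu_closure (fspan B)"
  then show "f \<in> S" using span unfolding lu_closure_def by (intro closed) blast
qed

lemma norm_fst_snd_le: "norm (fst u) \<le> norm u" "norm (snd u) \<le> norm u"
  using norm_fst_le[of "fst u" "snd u"] norm_snd_le[of "snd u" "fst u"] by simp_all

definition ridge_jet :: "(real \<Rightarrow> real \<times> real) \<Rightarrow> 'a::euclidean_space \<Rightarrow> real \<Rightarrow> 'a \<Rightarrow> real \<times> 'a" where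
  "ridge_jet \<phi> a b x = (fst (\<phi> (a \<bullet> x + b)), snd (\<phi> (a \<bullet> x + b)) *\<^sub>R a)"

text \<open>Univariate functions whose ridge functions all lie in \<open>M\<close> form a space to which
the one-dimensional results apply; dilations and translations are absorbed by the direction
\<open>a\<close> and the offset \<open>b\<close>.\<close>

lemma affine_jet_space_ridge:
  fixes M :: "('a::euclidean_space \<Rightarrow> real \<times> 'a) set"
  assumes "closed_function_space M"
  shows "affine_jet_space {\<phi>. \<forall>a b. ridge_jet \<phi> a b \<in> M}"
proof -
  interpret M: closed_function_space M by fact
  show ?thesis
  proof
    show "(\<lambda>_. 0) \<in> {\<phi>. \<forall>a b. ridge_jet \<phi> a b \<in> M}"
      using M.zero by (simp add: ridge_jet_def[abs_def] flip: zero_prod_def)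
  next
    fix f h assume fh: "f \<in> {\<phi>. \<forall>a b. ridge_jet \<phi> a b \<in> M}" "h \<in> {\<phi>. \<forall>a b. ridge_jet \<phi> a b \<in> M}"
    have "ridge_jet (\<lambda>t. f t + h t) a b = (\<lambda>x. ridge_jet f a b x + ridge_jet h a b x)" for a :: 'a and b
      by (simp add: ridge_jet_def fun_eq_iff scaleR_left_distrib)
    with fh show "(\<lambda>t. f t + h t) \<in> {\<phi>. \<forall>a b. ridge_jet \<phi> a b \<in> M}" by (auto intro!: M.add)
  next
    fix f and c :: real assume f: "f \<in> {\<phi>. \<forall>a b. ridge_jet \<phi> a b \<in> M}"
    have "ridge_jet (\<lambda>t. c *\<^sub>R f t) a b = (\<lambda>x. c *\<^sub>R ridge_jet f a b x)" for a :: 'a and b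
      by (simp add: ridge_jet_def fun_eq_iff)
    with f show "(\<lambda>t. c *\<^sub>R f t) \<in> {\<phi>. \<forall>a b. ridge_jet \<phi> a b \<in> M}" by (auto intro!: M.scale)
  next
    fix \<phi> and c d :: real assume \<phi>: "\<phi> \<in> {\<phi>. \<forall>a b. ridge_jet \<phi> a b \<in> M}"
    have "ridge_jet (\<lambda>t. (fst (\<phi> (c * t + d)), c * snd (\<phi> (c * t + d)))) a b = ridge_jet \<phi> (c *\<^sub>R a) (c * b + d)" for a :: 'a and b
      by (simp add: ridge_jet_def fun_eq_iff algebra_simps)
    with \<phi> show "(\<lambda>t. (fst (\<phi> (c * t + d)), c * snd (\<phi> (c * t + d)))) \<in> {\<phi>. \<forall>a b. ridge_jet \<phi> a b \<in> M}" by simp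
  next
    fix \<phi> assume lim: "\<And>R \<epsilon>. \<epsilon> > 0 \<Longrightarrow> \<exists>p\<in>{\<phi>. \<forall>a b. ridge_jet \<phi> a b \<in> M}. \<forall>t\<in>cball 0 R. norm (\<phi> t - p t) \<le> \<epsilon>"
    have "ridge_jet \<phi> a b \<in> M" for a b
    proof (rule M.closed)
      fix R \<epsilon> :: real assume "\<epsilon> > 0"
      have a1: "1 + norm a > 0" by (simp add: add_pos_nonneg)
      with \<open>\<epsilon> > 0\<close> have "\<epsilon> / (1 + norm a) > 0" by simp
      from lim[OF this, of "norm a * R + \<bar>b\<bar>"] obtain p where p: "\<And>a b. ridge_jet p a b \<in> M"
        "\<And>t. t \<in> cball 0 (norm a * R + \<bar>b\<bar>) \<Longrightarrow> norm (\<phi> t - p t) \<le> \<epsilon> / (1 + norm a)" by blast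
      have "norm (ridge_jet \<phi> a b x - ridge_jet p a b x) \<le> \<epsilon>" if "x \<in> cball 0 R" for x
      proof -
        define t where "t = a \<bullet> x + b"
        have "\<bar>a \<bullet> x\<bar> \<le> norm a * R"
          using Cauchy_Schwarz_ineq2[of a x] mult_left_mono[of "norm x" R "norm a"] that by simp
        then have "t \<in> cball 0 (norm a * R + \<bar>b\<bar>)" by (simp add: t_def)
        then have e: "norm (\<phi> t - p t) \<le> \<epsilon> / (1 + norm a)" by (rule p(2))
        have "ridge_jet \<phi> a b x - ridge_jet p a b x = (fst (\<phi> t - p t), snd (\<phi> t - p t) *\<^sub>R a)"
          by (simp add: ridge_jet_def t_def scaleR_left_diff_distrib)
        then have "norm (ridge_jet \<phi> a b x - ridge_jet p a b x) \<le> \<bar>fst (\<phi> t - p t)\<bar> + \<bar>snd (\<phi> t - p t)\<bar> * norm a"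
          using norm_Pair_le[of "fst (\<phi> t - p t)" "snd (\<phi> t - p t) *\<^sub>R a"] by simp
        also have "\<dots> \<le> norm (\<phi> t - p t) + norm (\<phi> t - p t) * norm a"
          using norm_fst_snd_le[of "\<phi> t - p t"]
          by (intro add_mono mult_right_mono) (simp_all del: fst_diff snd_diff)
        also have "\<dots> = norm (\<phi> t - p t) * (1 + norm a)" by (simp add: distrib_left)
        also have "\<dots> \<le> \<epsilon>" using e a1 by (simp add: pos_le_divide_eq)
        finally show ?thesis .
      qed
      with p(1) show "\<exists>p\<in>M. \<forall>x\<in>cball 0 R. norm (ridge_jet \<phi> a b x - p x) \<le> \<epsilon>" by blast
    qed
    then show "\<phi> \<in> {\<phi>. \<forall>a b. ridge_jet \<phi> a b \<in> M}" by blast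
  qed
qed

text \<open>Product of two functions on the level of jets, by the Leibniz rule.\<close>

definition jet_times :: "real \<times> 'a::real_normed_vector \<Rightarrow> real \<times> 'a \<Rightarrow> real \<times> 'a" where
  "jet_times u v = (fst u * fst v, fst u *\<^sub>R snd v + fst v *\<^sub>R snd u)"

lemma norm_jet_times_le: "norm (jet_times u v) \<le> 3 * (norm u * norm v)"
proof -
  have "norm (jet_times u v) \<le> \<bar>fst u * fst v\<bar> + norm (fst u *\<^sub>R snd v + fst v *\<^sub>R snd u)"
    unfolding jet_times_def using norm_Pair_le by (metis real_norm_def)
  also have "\<dots> \<le> \<bar>fst u * fst v\<bar> + (\<bar>fst u\<bar> * norm (snd v) + \<bar>fst v\<bar> * norm (snd u))"
    using norm_triangle_ineq[of "fst u *\<^sub>R snd v" "fst v *\<^sub>R snd u"] by simp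
  also have "\<dots> \<le> norm u * norm v + (norm u * norm v + norm v * norm u)"
    unfolding abs_mult using norm_fst_snd_le[of u] norm_fst_snd_le[of v]
    by (intro add_mono mult_mono) auto
  finally show ?thesis by (simp add: mult.commute)
qed

lemma jet_times_diff:
  "jet_times u v - jet_times u' v' = jet_times (u - u') v + jet_times u' (v - v')"
  by (simp add: jet_times_def algebra_simps)

text \<open>Exponential ridge functions are closed under products, so their span is an algebra. This is
how products of ridge functions become accessible, although a product of networks is not a
network.\<close>

definition exp_ridges :: "('a::euclidean_space \<Rightarrow> real \<times> 'a) set" where
  "exp_ridges = {ridge_jet (\<lambda>t. (exp t, exp t)) a b |a b. True}"

definition exp_jets :: "('a::euclidean_space \<Rightarrow> real \<times> 'a) set" where
  "exp_jets = lu_closure (fspan exp_ridges)"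

lemma exp_ridges_times:
  assumes "f \<in> exp_ridges" "h \<in> exp_ridges"
  shows "(\<lambda>x. jet_times (f x) (h x)) \<in> exp_ridges"
proof -
  obtain a b c d where f: "f = ridge_jet (\<lambda>t. (exp t, exp t)) a b" and h: "h = ridge_jet (\<lambda>t. (exp t, exp t)) c d"
    using assms unfolding exp_ridges_def by blast
  have "(\<lambda>x. jet_times (f x) (h x)) = ridge_jet (\<lambda>t. (exp t, exp t)) (a + c) (b + d)"
    unfolding f h by (simp add: fun_eq_iff jet_times_def ridge_jet_def algebra_simps exp_add)
  then show ?thesis unfolding exp_ridges_def by blast
qed

lemma fspan_times:
  assumes "f \<in> fspan exp_ridges" "h \<in> fspan exp_ridges"
  shows "(\<lambda>x. jet_times (f x) (h x)) \<in> fspan exp_ridges"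
  using assms(1)
proof (induction rule: fspan.induct)
  case fspan_zero
  show ?case by (simp add: jet_times_def fspan.fspan_zero flip: zero_prod_def)
next
  case (fspan_step f r c)
  have "(\<lambda>x. jet_times (r x) (h x)) \<in> fspan exp_ridges"
    using assms(2)
  proof (induction rule: fspan.induct)
    case fspan_zero
    show ?case by (simp add: jet_times_def fspan.fspan_zero flip: zero_prod_def)
  next
    case (fspan_step h s d)
    have "jet_times (r x) (h x + d *\<^sub>R s x) = jet_times (r x) (h x) + d *\<^sub>R jet_times (r x) (s x)" for x
      by (simp add: jet_times_def algebra_simps)
    then show ?case
      using fspan.fspan_step[OF fspan_step.IH exp_ridges_times[OF \<open>r \<in> exp_ridges\<close> fspan_step.hyps(2)], of d]
      by (simp only:)
  qed
  moreover have "jet_times (f x + c *\<^sub>R r x) (h x) = jet_times (f x) (h x) + c *\<^sub>R jet_times (r x) (h x)" for x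
    by (simp add: jet_times_def algebra_simps)
  ultimately show ?case using fspan_add[OF fspan_step.IH fspan_scale, of _ c] by (simp only:)
qed

lemma fspan_bounded:
  assumes "f \<in> fspan exp_ridges"
  shows "\<exists>B. \<forall>x\<in>cball 0 R. norm (f x) \<le> B"
proof -
  have "continuous_on UNIV f"
    using assms
    by (induction rule: fspan.induct) (auto simp: exp_ridges_def ridge_jet_def[abs_def] intro!: continuous_intros)
  then have "compact (f ` cball 0 R)"
    by (intro compact_continuous_image) (auto intro: continuous_on_subset)
  then show ?thesis using compact_imp_bounded[of "f ` cball 0 R"] unfolding bounded_iff by auto
qed

lemma exp_jets_bounded:
  assumes "f \<in> exp_jets"
  shows "\<exists>B. \<forall>x\<in>cball 0 R. norm (f x) \<le> B"
proof -
  obtain p where p: "p \<in> fspan exp_ridges" "\<And>x. x \<in> cball 0 R \<Longrightarrow> norm (f x - p x) \<le> 1"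
    using lu_closureD[OF assms[unfolded exp_jets_def] zero_less_one] by blast
  obtain B where B: "\<forall>x\<in>cball 0 R. norm (p x) \<le> B" using fspan_bounded[OF p(1)] by blast
  have "norm (f x) \<le> B + 1" if "x \<in> cball 0 R" for x
    using p(2)[OF that] bspec[OF B that] norm_triangle_sub[of "f x" "p x"] by simp
  then show ?thesis by blast
qed

lemma exp_jets_times:
  assumes f: "f \<in> exp_jets" and h: "h \<in> exp_jets"
  shows "(\<lambda>x. jet_times (f x) (h x)) \<in> exp_jets"
  unfolding exp_jets_def lu_closure_def
proof (intro CollectI allI impI)
  fix R \<epsilon> :: real assume e: "\<epsilon> > 0"
  obtain Bh0 where "\<forall>x\<in>cball 0 R. norm (h x) \<le> Bh0" using exp_jets_bounded[OF h] by blast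
  define Bh where "Bh = \<bar>Bh0\<bar> + 1"
  have Bh: "Bh > 0" "\<And>x. x \<in> cball 0 R \<Longrightarrow> norm (h x) \<le> Bh"
    using \<open>\<forall>x\<in>cball 0 R. norm (h x) \<le> Bh0\<close> by (force simp: Bh_def)+
  (* the bound of p is known only once p is chosen, so q is chosen after p *)
  have "\<epsilon> / (6 * Bh) > 0" using e Bh by simp
  then obtain p where p: "p \<in> fspan exp_ridges" "\<And>x. x \<in> cball 0 R \<Longrightarrow> norm (f x - p x) \<le> \<epsilon> / (6 * Bh)"
    using lu_closureD[OF f[unfolded exp_jets_def]] by blast
  obtain Bp0 where "\<forall>x\<in>cball 0 R. norm (p x) \<le> Bp0" using fspan_bounded[OF p(1)] by blast
  define Bp where "Bp = \<bar>Bp0\<bar> + 1"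
  have Bp: "Bp > 0" "\<And>x. x \<in> cball 0 R \<Longrightarrow> norm (p x) \<le> Bp"
    using \<open>\<forall>x\<in>cball 0 R. norm (p x) \<le> Bp0\<close> by (force simp: Bp_def)+
  have "\<epsilon> / (6 * Bp) > 0" using e Bp by simp
  then obtain q where q: "q \<in> fspan exp_ridges" "\<And>x. x \<in> cball 0 R \<Longrightarrow> norm (h x - q x) \<le> \<epsilon> / (6 * Bp)"
    using lu_closureD[OF h[unfolded exp_jets_def]] by blast
  have "norm (jet_times (f x) (h x) - jet_times (p x) (q x)) \<le> \<epsilon>" if x: "x \<in> cball 0 R" for x
  proof -
    have "norm (jet_times (f x - p x) (h x)) \<le> 3 * (norm (f x - p x) * norm (h x))" by (rule norm_jet_times_le)
    also have "\<dots> \<le> 3 * (\<epsilon> / (6 * Bh) * Bh)" using p(2)[OF x] Bh(2)[OF x] e Bh(1) by (intro mult_left_mono mult_mono) auto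
    finally have 1: "norm (jet_times (f x - p x) (h x)) \<le> \<epsilon> / 2" using Bh(1) by simp
    have "norm (jet_times (p x) (h x - q x)) \<le> 3 * (norm (p x) * norm (h x - q x))" by (rule norm_jet_times_le)
    also have "\<dots> \<le> 3 * (Bp * (\<epsilon> / (6 * Bp)))" using q(2)[OF x] Bp(2)[OF x] e Bp(1) by (intro mult_left_mono mult_mono) auto
    finally have 2: "norm (jet_times (p x) (h x - q x)) \<le> \<epsilon> / 2" using Bp(1) by simp
    show ?thesis
      unfolding jet_times_diff
      using norm_triangle_ineq[of "jet_times (f x - p x) (h x)" "jet_times (p x) (h x - q x)"] 1 2 by linarith
  qed
  then show "\<exists>p\<in>fspan exp_ridges. \<forall>x\<in>cball 0 R. norm (jet_times (f x) (h x) - p x) \<le> \<epsilon>"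
    using fspan_times[OF p(1) q(1)] by (intro bexI) auto
qed

interpretation exp_jets: closed_function_space "exp_jets :: ('a::euclidean_space \<Rightarrow> real \<times> 'a) set"
  unfolding exp_jets_def by (rule closed_function_space_lu_closure)

text \<open>All derivatives of \<open>exp\<close> are nonzero at \<open>0\<close>, so the one-dimensional
argument applies to \<open>exp\<close> without smoothing.\<close>

lemma exp_jets_ridge:
  fixes a :: "'a::euclidean_space"
  assumes "\<And>t. (f has_real_derivative f' t) (at t)" "continuous_on UNIV f'"
  shows "ridge_jet (\<lambda>t. (f t, f' t)) a b \<in> exp_jets"
proof -
  interpret affine_jet_space "{\<phi>. \<forall>a b. ridge_jet \<phi> a b \<in> (exp_jets :: ('a \<Rightarrow> real \<times> 'a) set)}"
    by (rule affine_jet_space_ridge) unfold_locales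
  have "ridge_jet (\<lambda>t. (exp t, exp t)) a b \<in> exp_jets" for a :: 'a and b
    unfolding exp_jets_def using subset_lu_closure fspan_base exp_ridges_def by blast
  then show ?thesis using all_C1_of_exp[OF _ assms] by blast
qed

text \<open>The second component is the gradient of the product that the Leibniz rule gives.\<close>

lemma exp_jets_prod:
  fixes f :: "'i \<Rightarrow> 'a::euclidean_space \<Rightarrow> real"
  assumes "finite I" "\<And>i. i \<in> I \<Longrightarrow> (\<lambda>x. (f i x, f' i x)) \<in> exp_jets"
  shows "(\<lambda>x. (\<Prod>i\<in>I. f i x, \<Sum>i\<in>I. (\<Prod>j\<in>I - {i}. f j x) *\<^sub>R f' i x)) \<in> exp_jets"
  using assms
proof (induction I rule: finite_induct)
  case empty
  have "ridge_jet (\<lambda>t. (1, 0)) 0 0 \<in> (exp_jets :: ('a \<Rightarrow> real \<times> 'a) set)"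
    by (rule exp_jets_ridge) auto
  then show ?case by (simp add: ridge_jet_def[abs_def])
next
  case (insert k I)
  have "(\<lambda>x. jet_times (f k x, f' k x) (\<Prod>i\<in>I. f i x, \<Sum>i\<in>I. (\<Prod>j\<in>I - {i}. f j x) *\<^sub>R f' i x)) \<in> exp_jets"
    using insert by (intro exp_jets_times) auto
  moreover have "(\<Sum>i\<in>insert k I. (\<Prod>j\<in>insert k I - {i}. f j x) *\<^sub>R f' i x)
      = f k x *\<^sub>R (\<Sum>i\<in>I. (\<Prod>j\<in>I - {i}. f j x) *\<^sub>R f' i x) + (\<Prod>i\<in>I. f i x) *\<^sub>R f' k x" for x
  proof -
    have "insert k I - {i} = insert k (I - {i})" "k \<notin> I - {i}" if "i \<in> I" for i using that insert.hyps by auto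
    then have "(\<Sum>i\<in>I. (\<Prod>j\<in>insert k I - {i}. f j x) *\<^sub>R f' i x) = (\<Sum>i\<in>I. f k x *\<^sub>R ((\<Prod>j\<in>I - {i}. f j x) *\<^sub>R f' i x))"
      using insert.hyps by (intro sum.cong) auto
    moreover have "insert k I - {k} = I" using insert.hyps by auto
    ultimately show ?thesis using insert.hyps by (simp add: scaleR_sum_right)
  qed
  ultimately show ?case using insert.hyps by (simp add: jet_times_def add.commute)
qed

text \<open>The ridge functions of \<open>\<sigma>\<close> yield those of \<open>exp\<close>, and these
span \<open>exp_jets\<close>.\<close>

theorem exp_jets_subset:
  assumes M: "closed_function_space (M :: ('a::euclidean_space \<Rightarrow> real \<times> 'a) set)"
    and ridge: "\<And>a b. ridge_jet (\<lambda>t. (\<sigma> t, \<sigma>' t)) a b \<in> M"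
    and \<sigma>: "\<And>t. (\<sigma> has_real_derivative \<sigma>' t) (at t)" "continuous_on UNIV \<sigma>'"
      "bounded_energy \<sigma>" "\<sigma> \<noteq> (\<lambda>_. 0)"
  shows "exp_jets \<subseteq> M"
proof -
  interpret M: closed_function_space M by fact
  interpret affine_jet_space "{\<phi>. \<forall>a b. ridge_jet \<phi> a b \<in> M}" using M by (rule affine_jet_space_ridge)
  have "(\<lambda>t. (exp t, exp t)) \<in> {\<phi>. \<forall>a b. ridge_jet \<phi> a b \<in> M}"
    using all_C1_of_activation[OF _ \<sigma> DERIV_exp continuous_on_exp[OF continuous_on_id]] ridge by blast
  then have "exp_ridges \<subseteq> M" unfolding exp_ridges_def by blast
  then show ?thesis unfolding exp_jets_def by (rule M.lu_closure_fspan_subset)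
qed

section \<open>An almost exact potential on a compact set\<close>

text \<open>\<open>chain K e \<delta> x y l w\<close>: there is a finite sequence in \<open>K\<close>
from \<open>x\<close> to \<open>y\<close> with steps of size at most \<open>\<delta>\<close>, of total
length \<open>l\<close> and of total cost \<open>w\<close>, where a step from \<open>u\<close> to
\<open>v\<close> costs \<open>e u v\<close>.\<close>

inductive chain :: "'a::euclidean_space set \<Rightarrow> ('a \<Rightarrow> 'a \<Rightarrow> real) \<Rightarrow> real \<Rightarrow> 'a \<Rightarrow> 'a \<Rightarrow> real \<Rightarrow> real \<Rightarrow> bool"
  for K e \<delta> where
  start: "x \<in> K \<Longrightarrow> chain K e \<delta> x x 0 0"
| step: "chain K e \<delta> x y l w \<Longrightarrow> z \<in> K \<Longrightarrow> dist y z \<le> \<delta>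
    \<Longrightarrow> chain K e \<delta> x z (l + dist y z) (w + e y z)"

lemma chain_mono: "chain K e \<delta> x y l w \<Longrightarrow> \<delta> \<le> \<delta>' \<Longrightarrow> chain K e \<delta>' x y l w"
  by (induction rule: chain.induct) (auto intro: chain.intros)

lemma chain_endpoints:
  assumes "chain K e \<delta> x y l w"
  shows "x \<in> K \<and> y \<in> K \<and> dist x y \<le> l"
  using assms
proof (induction rule: chain.induct)
  case (step x y l w z)
  then show ?case using dist_triangle[of x z y] by auto
qed auto

text \<open>Cut at the last point that is reached within length \<open>a\<close>. As steps are at most
\<open>\<delta>\<close>, the first part is shorter than \<open>a\<close> by at most
\<open>\<delta>\<close>, unless the chain ends before.\<close>

lemma chain_split:
  assumes "chain K e \<delta> x y l w" "0 \<le> a" "0 \<le> \<delta>"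
  shows "\<exists>z l1 w1 l2 w2. chain K e \<delta> x z l1 w1 \<and> chain K e \<delta> z y l2 w2 \<and> l = l1 + l2 \<and> w = w1 + w2
     \<and> l1 \<le> a \<and> (a - \<delta> \<le> l1 \<or> (z = y \<and> l2 = 0 \<and> w2 = 0))"
  using assms(1)
proof (induction rule: chain.induct)
  case (start x)
  then show ?case using assms
    by (intro exI[of _ x] exI[of _ "0::real"]) (auto intro: chain.start)
next
  case (step x y l w v)
  then obtain z l1 w1 l2 w2 where z: "chain K e \<delta> x z l1 w1" "chain K e \<delta> z y l2 w2" "l = l1 + l2"
     "w = w1 + w2" "l1 \<le> a" "a - \<delta> \<le> l1 \<or> (z = y \<and> l2 = 0 \<and> w2 = 0)" by blast
  show ?case
  proof (cases "a - \<delta> \<le> l1")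
    case True
    have "chain K e \<delta> z v (l2 + dist y v) (w2 + e y v)"
      using chain.step[OF z(2) step.hyps(2,3)] .
    then show ?thesis using z True
      by (intro exI[of _ z] exI[of _ l1] exI[of _ w1] exI[of _ "l2 + dist y v"] exI[of _ "w2 + e y v"])
        auto
  next
    case False
    then have zy: "z = y" "l2 = 0" "w2 = 0" using z(6) by auto
    have "chain K e \<delta> x v (l1 + dist y v) (w1 + e y v)"
      using chain.step[OF _ step.hyps(2,3)] z(1) zy by blast
    moreover have "l1 + dist y v \<le> a" using False step.hyps(3) by simp
    ultimately show ?thesis using z zy step.hyps(2)
      by (intro exI[of _ v] exI[of _ "l1 + dist y v"] exI[of _ "w1 + e y v"] exI[of _ "0::real"])
        (auto intro: chain.start)
  qed
qed

locale compact_differential =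
  fixes K :: "'a::euclidean_space set" and H :: "'a \<Rightarrow> real" and g :: "'a \<Rightarrow> 'a"
  assumes compact_K: "compact K"
    and cont_g: "continuous_on K g"
    and deriv_H: "\<And>x. x \<in> K \<Longrightarrow> (H has_derivative (\<lambda>h. h \<bullet> g x)) (at x within K)"
begin

text \<open>Increment of \<open>H\<close> predicted by the first order expansion at \<open>x\<close>,
minus the actual increment. The \<open>H\<close>-part telescopes along a chain.\<close>

definition defect :: "'a \<Rightarrow> 'a \<Rightarrow> real" where
  "defect x y = (y - x) \<bullet> g x - (H y - H x)"

abbreviation "K_chain \<equiv> chain K defect"

text \<open>Along a chain on which \<open>g\<close> differs from a fixed vector \<open>v\<close> by at
most \<open>\<kappa>\<close>, the cost is that of a single step with gradient \<open>v\<close>, up to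
\<open>\<kappa>\<close> times the length.\<close>

lemma chain_cost_ge:
  assumes "K_chain \<delta> x y l w" and "\<And>z. z \<in> K \<Longrightarrow> dist x z \<le> l \<Longrightarrow> norm (g z - v) \<le> \<kappa>"
  shows "(y - x) \<bullet> v - \<kappa> * l - (H y - H x) \<le> w"
  using assms
proof (induction rule: chain.induct)
  case (step x y l w z)
  have l: "x \<in> K \<and> y \<in> K \<and> dist x y \<le> l" using chain_endpoints[OF step.hyps(1)] .
  have "(y - x) \<bullet> v - \<kappa> * l - (H y - H x) \<le> w"
    using step.IH step.prems by (meson add_increasing2 zero_le_dist)
  moreover have "norm (g y - v) \<le> \<kappa>" using step.prems[of y] l by (simp add: add_increasing2)
  then have "norm (z - y) * norm (g y - v) \<le> dist y z * \<kappa>"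
    by (simp add: dist_norm norm_minus_commute mult_left_mono)
  then have "\<bar>(z - y) \<bullet> (g y - v)\<bar> \<le> dist y z * \<kappa>"
    using Cauchy_Schwarz_ineq2[of "z - y" "g y - v"] by linarith
  then have "- (dist y z * \<kappa>) \<le> (z - y) \<bullet> (g y - v)" by linarith
  moreover have "(z - x) \<bullet> v = (y - x) \<bullet> v + (z - y) \<bullet> v" by (simp add: inner_diff_left)
  ultimately show ?case
    unfolding defect_def by (simp add: algebra_simps inner_diff_right)
qed simp

text \<open>Arbitrarily close to \<open>x\<close> start chains with arbitrarily small steps, of length
about \<open>s\<close> at most, whose cost is at most about \<open>- \<kappa> * s\<close>. The scale
\<open>s\<close> will be halved repeatedly.\<close>

definition cheap_chains_near :: "real \<Rightarrow> 'a \<Rightarrow> real \<Rightarrow> bool" where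
  "cheap_chains_near \<kappa> x s \<longleftrightarrow> (\<forall>d>0. \<exists>x' y l w. K_chain d x' y l w \<and> dist x x' \<le> d \<and> l \<le> s + d \<and> w \<le> - \<kappa> * s + d)"

text \<open>By compactness the starting points of the chains may be assumed to converge.\<close>

lemma cheap_chains_limit:
  assumes "\<And>d. d > 0 \<Longrightarrow> \<exists>x' y l w. K_chain d x' y l w \<and> dist z x' \<le> r + d \<and> l \<le> s + d \<and> w \<le> - \<kappa> * s + d"
  shows "\<exists>x\<in>K. cheap_chains_near \<kappa> x s \<and> dist z x \<le> r"
proof -
  have "\<exists>x' y l w. K_chain (inverse (Suc n)) x' y l w \<and> dist z x' \<le> r + inverse (Suc n)
      \<and> l \<le> s + inverse (Suc n) \<and> w \<le> - \<kappa> * s + inverse (Suc n)" for n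
    using assms[of "inverse (Suc n)"] by simp
  then obtain X Y L W where XY: "\<And>n. K_chain (inverse (Suc n)) (X n) (Y n) (L n) (W n) \<and> dist z (X n) \<le> r + inverse (Suc n)
      \<and> L n \<le> s + inverse (Suc n) \<and> W n \<le> - \<kappa> * s + inverse (Suc n)"
    by metis
  have "\<forall>n. X n \<in> K" using XY chain_endpoints by blast
  with compact_K obtain x \<phi> where x: "x \<in> K" "strict_mono \<phi>" "(X \<circ> \<phi>) \<longlonglongrightarrow> x"
    unfolding compact_def by blast
  have inv0: "(\<lambda>n. inverse (real (Suc (\<phi> n)))) \<longlonglongrightarrow> 0"
    using LIMSEQ_subseq_LIMSEQ[OF LIMSEQ_inverse_real_of_nat x(2)] by (simp add: o_def)
  have "cheap_chains_near \<kappa> x s"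
    unfolding cheap_chains_near_def
  proof (intro allI impI)
    fix d :: real assume "d > 0"
    have "eventually (\<lambda>n. dist ((X \<circ> \<phi>) n) x < d) sequentially" using x(3) \<open>d > 0\<close> by (rule tendstoD)
    moreover have "eventually (\<lambda>n. inverse (real (Suc (\<phi> n))) < d) sequentially"
      using inv0 \<open>d > 0\<close> by (rule order_tendstoD)
    ultimately have "eventually (\<lambda>n. dist ((X \<circ> \<phi>) n) x < d \<and> inverse (real (Suc (\<phi> n))) < d) sequentially"
      by eventually_elim auto
    then obtain n where n: "dist (X (\<phi> n)) x < d" "inverse (real (Suc (\<phi> n))) < d"
      by (auto simp: eventually_sequentially)
    show "\<exists>x' y l w. K_chain d x' y l w \<and> dist x x' \<le> d \<and> l \<le> s + d \<and> w \<le> - \<kappa> * s + d"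
      using XY[of "\<phi> n"] n chain_mono[of K defect _ _ _ _ _ d]
      by (intro exI[of _ "X (\<phi> n)"] exI[of _ "Y (\<phi> n)"] exI[of _ "L (\<phi> n)"] exI[of _ "W (\<phi> n)"])
        (auto simp: dist_commute)
  qed
  moreover have "dist z x \<le> r"
  proof -
    have "(\<lambda>n. dist z ((X \<circ> \<phi>) n)) \<longlonglongrightarrow> dist z x" using x(3) by (intro tendsto_intros)
    moreover have "(\<lambda>n. r + inverse (real (Suc (\<phi> n)))) \<longlonglongrightarrow> r + 0" using inv0 by (intro tendsto_intros)
    ultimately show ?thesis
      using LIMSEQ_le[of "\<lambda>n. dist z ((X \<circ> \<phi>) n)" "dist z x" "\<lambda>n. r + inverse (real (Suc (\<phi> n)))" "r + 0"] XY
      by (auto simp: o_def)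
  qed
  ultimately show ?thesis using x(1) by blast
qed

text \<open>One of the two halves of a cheap chain is at least as cheap relative to its length. Which
half it is may depend on the step size, so the new starting points converge only along a
subsequence.\<close>

lemma cheap_chains_halve:
  assumes "cheap_chains_near \<kappa> x s" "s \<ge> 0"
  shows "\<exists>x'\<in>K. cheap_chains_near \<kappa> x' (s / 2) \<and> dist x x' \<le> s / 2"
proof (rule cheap_chains_limit)
  fix d :: real assume "d > 0"
  then obtain x' y l w where c: "K_chain (d/2) x' y l w" "dist x x' \<le> d/2" "l \<le> s + d/2" "w \<le> - \<kappa> * s + d/2"
    using assms(1) unfolding cheap_chains_near_def by (meson half_gt_zero)
  obtain z l1 w1 l2 w2 where z: "K_chain (d/2) x' z l1 w1" "K_chain (d/2) z y l2 w2" "l = l1 + l2" "w = w1 + w2"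
     "l1 \<le> s/2" "s/2 - d/2 \<le> l1 \<or> (z = y \<and> l2 = 0 \<and> w2 = 0)"
    using chain_split[OF c(1), of "s/2"] assms(2) \<open>d > 0\<close> by auto
  have l2: "l2 \<le> s/2 + d" using z c(3) assms(2) \<open>d > 0\<close> by auto
  have dz: "dist x z \<le> s/2 + d"
    using chain_endpoints[OF z(1)] dist_triangle[of x z x'] c(2) z(5) \<open>d > 0\<close> by auto
  have mono: "K_chain d x' z l1 w1" "K_chain d z y l2 w2"
    using chain_mono[OF z(1)] chain_mono[OF z(2)] \<open>d > 0\<close> by auto
  show "\<exists>x' y l w. K_chain d x' y l w \<and> dist x x' \<le> s/2 + d \<and> l \<le> s/2 + d \<and> w \<le> - \<kappa> * (s/2) + d"
  proof (cases "w1 \<le> - \<kappa> * (s/2) + d")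
    case True
    then show ?thesis using mono(1) c(2) z(5) assms(2) \<open>d > 0\<close>
      by (intro exI[of _ x'] exI[of _ z] exI[of _ l1] exI[of _ w1]) auto
  next
    case False
    then have "w2 \<le> - \<kappa> * (s/2) + d" using z(4) c(4) \<open>d > 0\<close> by (simp add: algebra_simps)
    then show ?thesis using mono(2) dz l2
      by (intro exI[of _ z] exI[of _ y] exI[of _ l2] exI[of _ w2]) auto
  qed
qed

text \<open>The starting points at the scales \<open>T / 2 ^ n\<close> form a Cauchy sequence; its limit
is close to all of them on their own scale.\<close>

lemma cheap_chains_nested:
  assumes "x \<in> K" "cheap_chains_near \<kappa> x T" "T \<ge> 0"
  obtains p X where "p \<in> K" "\<And>n. cheap_chains_near \<kappa> (X n) (T / 2 ^ n)" "\<And>n. dist (X n) p \<le> 2 * T / 2 ^ n"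
proof -
  have "\<exists>X. \<forall>n. (X n \<in> K \<and> cheap_chains_near \<kappa> (X n) (T / 2 ^ n)) \<and> dist (X n) (X (Suc n)) \<le> T / 2 ^ n / 2"
  proof (rule dependent_nat_choice)
    show "\<exists>x. x \<in> K \<and> cheap_chains_near \<kappa> x (T / 2 ^ 0)" using assms by auto
  next
    fix y n assume "y \<in> K \<and> cheap_chains_near \<kappa> y (T / 2 ^ n)"
    then show "\<exists>x'. (x' \<in> K \<and> cheap_chains_near \<kappa> x' (T / 2 ^ Suc n)) \<and> dist y x' \<le> T / 2 ^ n / 2"
      using cheap_chains_halve[of \<kappa> y "T / 2 ^ n"] assms(3) by (auto simp: field_simps)
  qed
  then obtain X where X: "\<And>n. X n \<in> K" "\<And>n. cheap_chains_near \<kappa> (X n) (T / 2 ^ n)"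
    "\<And>n. dist (X n) (X (Suc n)) \<le> T / 2 ^ n / 2" by blast
  have d: "dist (X n) (X (n + j)) \<le> T / 2 ^ n * (2 - 1 / 2 ^ j)" for n j
  proof (induction j)
    case 0 then show ?case using assms(3) by simp
  next
    case (Suc j)
    have "dist (X n) (X (n + Suc j)) \<le> dist (X n) (X (n + j)) + dist (X (n + j)) (X (n + Suc j))"
      by (rule dist_triangle)
    also have "\<dots> \<le> T / 2 ^ n * (2 - 1 / 2 ^ j) + T / 2 ^ (n + j) / 2"
      using Suc X(3)[of "n + j"] by simp
    also have "\<dots> = T / 2 ^ n * (2 - 1 / 2 ^ Suc j)" by (simp add: field_simps power_add)
    finally show ?case .
  qed
  have d2: "dist (X n) (X (n + j)) \<le> 2 * T / 2 ^ n" for n j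
  proof -
    have "T / 2 ^ n * (2 - 1 / 2 ^ j) \<le> T / 2 ^ n * 2" using assms(3) by (intro mult_left_mono) auto
    with d[of n j] show ?thesis by simp
  qed
  obtain p \<phi> where p: "p \<in> K" "strict_mono \<phi>" "(X \<circ> \<phi>) \<longlonglongrightarrow> p"
    using compact_K X(1) unfolding compact_def by blast
  have "dist (X n) p \<le> 2 * T / 2 ^ n" for n
  proof (rule LIMSEQ_le_const2)
    show "(\<lambda>m. dist (X n) ((X \<circ> \<phi>) m)) \<longlonglongrightarrow> dist (X n) p" using p(3) by (intro tendsto_intros)
    show "\<exists>N. \<forall>m\<ge>N. dist (X n) ((X \<circ> \<phi>) m) \<le> 2 * T / 2 ^ n"
    proof (intro exI[of _ n] allI impI)
      fix m assume "n \<le> m"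
      then have "n \<le> \<phi> m" using seq_suble[OF p(2), of m] by simp
      then show "dist (X n) ((X \<circ> \<phi>) m) \<le> 2 * T / 2 ^ n" using d2[of n "\<phi> m - n"] by simp
    qed
  qed
  with p(1) X(2) that show ?thesis by blast
qed

text \<open>At the limit point \<open>p\<close> of the halving, differentiability of \<open>H\<close> and
continuity of \<open>g\<close> make the cost of a chain on the scale \<open>s\<close> at least \<open>-
\<kappa> * s / 2\<close>, which contradicts a cost of about \<open>- \<kappa> * s\<close>.\<close>

lemma no_cheap_chains:
  assumes "x \<in> K" "\<kappa> > 0" "T > 0"
  shows "\<not> cheap_chains_near \<kappa> x T"
proof
  assume "cheap_chains_near \<kappa> x T"
  then obtain p X where p: "p \<in> K" "\<And>n. cheap_chains_near \<kappa> (X n) (T / 2 ^ n)" "\<And>n. dist (X n) p \<le> 2 * T / 2 ^ n"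
    using cheap_chains_nested assms by (metis less_eq_real_def)
  obtain r1 where r1: "r1 > 0" "\<And>z. z \<in> K \<Longrightarrow> dist z p < r1 \<Longrightarrow> dist (g z) (g p) < \<kappa> / 4"
    using cont_g p(1) assms(2) unfolding continuous_on_iff by (metis divide_pos_pos zero_less_numeral)
  obtain r2 where r2: "r2 > 0" "\<And>z. z \<in> K \<Longrightarrow> norm (z - p) < r2 \<Longrightarrow>
      norm (H z - H p - (z - p) \<bullet> g p) \<le> \<kappa> / 64 * norm (z - p)"
    using deriv_H[OF p(1)] assms(2) unfolding has_derivative_within_alt by (metis divide_pos_pos zero_less_numeral)
  (* a scale so small that the chains, which stay within 4 * s of p, lie in both neighbourhoods *)
  obtain n where n: "T / 2 ^ n < min r1 r2 / 5"
  proof -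
    obtain n where "(1/2) ^ n < min r1 r2 / 5 / T"
      using real_arch_pow_inv[of "min r1 r2 / 5 / T" "1/2"] r1 r2 assms by auto
    then show ?thesis using that[of n] assms by (simp add: field_simps power_divide)
  qed
  define s where "s = T / 2 ^ n"
  have s: "s > 0" "5 * s < r1" "5 * s < r2" using n assms by (auto simp: s_def mult.commute)
  (* cost at least - (3/8 + 1/8) * kappa * s, but at most - kappa * s + d: impossible for d <= kappa * s / 4 *)
  define d where "d = min (s / 2) (\<kappa> * s / 4)"
  have d: "d > 0" "d \<le> s / 2" "d \<le> \<kappa> * s / 4" using s assms by (auto simp: d_def)
  obtain x' y l w where c: "K_chain d x' y l w" "dist (X n) x' \<le> d" "l \<le> s + d" "w \<le> - \<kappa> * s + d"
    using p(2)[of n] d(1) unfolding cheap_chains_near_def s_def by blast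
  have x'p: "dist x' p \<le> 2 * s + d"
    using p(3)[of n] c(2) dist_triangle[of x' p "X n"] by (auto simp: s_def dist_commute)
  have near: "dist z p \<le> 4 * s" if "dist x' z \<le> l" for z
    using x'p that c(3) d(2) dist_triangle[of z p x'] by (auto simp: dist_commute)
  have xy: "x' \<in> K" "y \<in> K" "dist x' y \<le> l" "0 \<le> l"
    using chain_endpoints[OF c(1)] order_trans[OF zero_le_dist[of x' y]] by auto
  have cost: "(y - x') \<bullet> g p - \<kappa> / 4 * l - (H y - H x') \<le> w"
  proof (rule chain_cost_ge[OF c(1)])
    fix z assume z: "z \<in> K" "dist x' z \<le> l"
    then have "dist z p < r1" using near s by force
    then show "norm (g z - g p) \<le> \<kappa> / 4" using r1(2)[OF z(1)] by (simp add: dist_norm)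
  qed
  have H: "\<bar>H z - H p - (z - p) \<bullet> g p\<bar> \<le> \<kappa> * s / 16" if "z \<in> K" "dist x' z \<le> l" for z
  proof -
    have z: "norm (z - p) \<le> 4 * s" using near[OF that(2)] by (simp add: dist_norm)
    have "\<bar>H z - H p - (z - p) \<bullet> g p\<bar> \<le> \<kappa> / 64 * norm (z - p)"
      using r2(2)[OF that(1)] z s by auto
    also have "\<dots> \<le> \<kappa> / 64 * (4 * s)" using z assms by (intro mult_left_mono) auto
    finally show ?thesis by simp
  qed
  note cost
  moreover have "(y - x') \<bullet> g p = (y - p) \<bullet> g p - (x' - p) \<bullet> g p" by (simp add: inner_diff_left)
  moreover have "\<kappa> / 4 * l \<le> \<kappa> / 4 * (3 / 2 * s)"
    using c(3) d assms by (intro mult_left_mono) auto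
  moreover have "\<kappa> * s > 0" using assms s by simp
  moreover have "\<bar>H y - H p - (y - p) \<bullet> g p\<bar> \<le> \<kappa> * s / 16" "\<bar>H x' - H p - (x' - p) \<bullet> g p\<bar> \<le> \<kappa> * s / 16"
    using H[of y] H[of x'] xy by auto
  moreover have "\<kappa> / 4 * (3 / 2 * s) = 3 / 8 * (\<kappa> * s)" "- \<kappa> * s = - (\<kappa> * s)" by auto
  ultimately show False
    using c(4) d(3) by linarith
qed

text \<open>Failure for every step size would give chains of length at most \<open>T\<close> and cost
below \<open>- \<eta>\<close>, which is cheap with the rate \<open>\<kappa> = \<eta> / T\<close>.\<close>

lemma short_chain_cost:
  assumes "T > 0" "\<eta> > 0"
  obtains \<delta> where "\<delta> > 0" "\<And>x y l w. K_chain \<delta> x y l w \<Longrightarrow> l \<le> T \<Longrightarrow> - \<eta> \<le> w"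
proof (rule ccontr)
  note assm = that
  assume "\<not> thesis"
  have bad: "\<exists>x y l w. K_chain d x y l w \<and> l \<le> T \<and> w < - \<eta>" if "d > 0" for d
  proof (rule ccontr)
    assume "\<nexists>x y l w. K_chain d x y l w \<and> l \<le> T \<and> w < - \<eta>"
    then have "- \<eta> \<le> w" if "K_chain d x y l w" "l \<le> T" for x y l w
      using that not_le by blast
    then show False using \<open>\<not> thesis\<close> assm[OF \<open>d > 0\<close>] by blast
  qed
  obtain R where R: "\<And>x. x \<in> K \<Longrightarrow> dist 0 x \<le> R"
    using compact_imp_bounded[OF compact_K] unfolding bounded_any_center[of K 0] by blast
  have "\<exists>x\<in>K. cheap_chains_near (\<eta> / T) x T \<and> dist 0 x \<le> R"
  proof (rule cheap_chains_limit)
    fix d :: real assume "d > 0"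
    then obtain x y l w where c: "K_chain d x y l w" "l \<le> T" "w < - \<eta>" using bad by blast
    have "dist 0 x \<le> R" using R chain_endpoints[OF c(1)] by blast
    with c show "\<exists>x' y l w. K_chain d x' y l w \<and> dist 0 x' \<le> R + d \<and> l \<le> T + d \<and> w \<le> - (\<eta> / T) * T + d"
      using \<open>d > 0\<close> assms by (intro exI[of _ x] exI[of _ y] exI[of _ l] exI[of _ w]) auto
  qed
  then show False using no_cheap_chains assms by auto
qed

text \<open>A long chain is cut into pieces of length between \<open>1 / c\<close> and \<open>2 /
c\<close>. Each piece costs at least \<open>- 1\<close>, which the term \<open>c * l\<close> compensates;
only the last, possibly shorter, piece can contribute a negative amount.\<close>

lemma chain_cost_bounded_below:
  assumes "c > 0"
  obtains \<delta> where "\<delta> > 0" "\<And>x y l w. K_chain \<delta> x y l w \<Longrightarrow> - 1 \<le> w + c * l"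
proof -
  obtain \<delta>0 where \<delta>0: "\<delta>0 > 0" "\<And>x y l w. K_chain \<delta>0 x y l w \<Longrightarrow> l \<le> 2 / c \<Longrightarrow> - 1 \<le> w"
    using short_chain_cost[of "2 / c" 1] assms by auto
  define \<delta> where "\<delta> = min \<delta>0 (1 / c)"
  have \<delta>: "\<delta> > 0" "\<delta> \<le> \<delta>0" "\<delta> \<le> 1 / c" using \<delta>0 assms by (auto simp: \<delta>_def)
  have short: "- 1 \<le> w" if "K_chain \<delta> x y l w" "l \<le> 2 / c" for x y l w
    using \<delta>0(2) chain_mono[OF that(1) \<delta>(2)] that(2) by blast
  have "- 1 \<le> w + c * l" if "K_chain \<delta> x y l w" "l \<le> real m / c" for m x y l w
    using that
  proof (induction m arbitrary: x l w)
    case 0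
    have "l \<le> 0" using 0(2) by simp
    then have "l = 0" using chain_endpoints[OF 0(1)] zero_le_dist[of x y] by linarith
    then show ?case using short[OF 0(1)] assms by simp
  next
    case (Suc m)
    have l0: "0 \<le> l" using chain_endpoints[OF Suc.prems(1)] zero_le_dist[of x y] by linarith
    show ?case
    proof (cases "l \<le> 2 / c")
      case True
      have "0 \<le> c * l" using l0 assms by simp
      then show ?thesis using short[OF Suc.prems(1) True] by simp
    next
      case False
      obtain z l1 w1 l2 w2 where z: "K_chain \<delta> x z l1 w1" "K_chain \<delta> z y l2 w2" "l = l1 + l2" "w = w1 + w2"
        "l1 \<le> 2 / c" "2 / c - \<delta> \<le> l1 \<or> (z = y \<and> l2 = 0 \<and> w2 = 0)"
        using chain_split[OF Suc.prems(1), of "2 / c"] assms \<delta> by auto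
      have l1: "1 / c \<le> l1"
        using z False \<delta>(3) by (auto simp: field_simps)
      then have "l2 \<le> real m / c" using Suc.prems(2) z(3) by (simp add: add_divide_distrib)
      then have "- 1 \<le> w2 + c * l2" using Suc.IH[OF z(2)] by blast
      moreover have "- 1 \<le> w1" using short[OF z(1,5)] .
      moreover have "1 \<le> c * l1" using l1 assms by (simp add: field_simps)
      ultimately show ?thesis using z by (simp add: distrib_left)
    qed
  qed
  moreover have "\<exists>m::nat. l \<le> real m / c" for l
    using real_arch_simple[of "l * c"] assms by (auto simp: field_simps)
  ultimately show ?thesis using that \<delta>(1) by blast
qed

text \<open>\<open>V\<close> is \<open>H\<close> plus the infimum of the costs of all chains that end at
the given point. Extending a chain by one step gives the upper estimate for \<open>V y - V x\<close>;
exchanging \<open>x\<close> and \<open>y\<close> gives the lower one, with \<open>g y\<close> in place of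
\<open>g x\<close>, and the uniform continuity of \<open>g\<close> accounts for the difference.\<close>

theorem uniform_potential:
  assumes "c > 0"
  shows "\<exists>V. \<exists>\<delta>>0. \<forall>x\<in>K. \<forall>y\<in>K. dist x y \<le> \<delta> \<longrightarrow> \<bar>V y - V x - (y - x) \<bullet> g x\<bar> \<le> c * dist x y"
proof -
  have c2: "c / 2 > 0" using assms by simp
  obtain \<delta>1 where \<delta>1: "\<delta>1 > 0" "\<And>x y l w. K_chain \<delta>1 x y l w \<Longrightarrow> - 1 \<le> w + c / 2 * l"
    using chain_cost_bounded_below[OF c2] by blast
  obtain \<delta>2 where \<delta>2: "\<delta>2 > 0" "\<And>x y. x \<in> K \<Longrightarrow> y \<in> K \<Longrightarrow> dist y x < \<delta>2 \<Longrightarrow> dist (g y) (g x) < c / 2"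
    using uniformly_continuous_onE[OF compact_uniformly_continuous[OF cont_g compact_K] c2] by metis
  define S where "S x = {w + c / 2 * l |y l w. K_chain \<delta>1 y x l w}" for x
  define V where "V x = H x + Inf (S x)" for x
  have bdd: "bdd_below (S x)" for x
    unfolding S_def using \<delta>1(2) by (intro bdd_belowI[of _ "-1"]) auto
  have step: "V y - V x \<le> (y - x) \<bullet> g x + c / 2 * dist x y" if "x \<in> K" "y \<in> K" "dist x y \<le> \<delta>1" for x y
  proof -
    have "S x \<noteq> {}" unfolding S_def using chain.start[OF that(1)] by blast
    moreover have "Inf (S y) - defect x y - c / 2 * dist x y \<le> t" if "t \<in> S x" for t
    proof -
      obtain v l w where t: "t = w + c / 2 * l" "K_chain \<delta>1 v x l w" using \<open>t \<in> S x\<close> unfolding S_def by blast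
      have "w + defect x y + c / 2 * (l + dist x y) \<in> S y"
        unfolding S_def using chain.step[OF t(2) \<open>y \<in> K\<close> \<open>dist x y \<le> \<delta>1\<close>] by blast
      then have "Inf (S y) \<le> w + defect x y + c / 2 * (l + dist x y)" using bdd by (rule cInf_lower)
      then show ?thesis using t by (simp add: field_simps)
    qed
    ultimately have "Inf (S y) - defect x y - c / 2 * dist x y \<le> Inf (S x)" by (rule cInf_greatest)
    then show ?thesis unfolding V_def defect_def by simp
  qed
  define \<delta> where "\<delta> = min \<delta>1 (\<delta>2 / 2)"
  have "\<bar>V y - V x - (y - x) \<bullet> g x\<bar> \<le> c * dist x y" if xy: "x \<in> K" "y \<in> K" "dist x y \<le> \<delta>" for x y
  proof -
    have d: "dist x y \<le> \<delta>1" "dist y x \<le> \<delta>1" "dist y x < \<delta>2"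
      using xy(3) \<delta>2(1) by (auto simp: \<delta>_def dist_commute)
    have "norm (g y - g x) \<le> c / 2" using \<delta>2(2)[OF xy(1,2) d(3)] by (simp add: dist_norm)
    then have "norm (y - x) * norm (g y - g x) \<le> dist x y * (c / 2)"
      unfolding dist_norm norm_minus_commute[of x y] by (intro mult_left_mono) auto
    then have "\<bar>(y - x) \<bullet> (g y - g x)\<bar> \<le> dist x y * (c / 2)"
      using Cauchy_Schwarz_ineq2[of "y - x" "g y - g x"] by linarith
    moreover have "(y - x) \<bullet> (g y - g x) = - ((x - y) \<bullet> g y) - (y - x) \<bullet> g x"
      by (simp add: inner_diff_left inner_diff_right)
    moreover have "V x - V y \<le> (x - y) \<bullet> g y + c / 2 * dist x y"
      using step[OF xy(2,1) d(2)] by (simp add: dist_commute)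
    moreover have "0 \<le> c * dist x y" "c / 2 * dist x y = c * dist x y / 2" "dist x y * (c / 2) = c * dist x y / 2"
      using assms by auto
    ultimately show ?thesis
      using step[OF xy(1,2) d(1)] by linarith
  qed
  moreover have "\<delta> > 0" using \<delta>1 \<delta>2 by (simp add: \<delta>_def)
  ultimately show ?thesis by blast
qed

end

section \<open>Quadratic B-splines and uniform approximation of the gradient\<close>

text \<open>Quadratic B-splines, written as differences of a \<open>C\<^sup>1\<close> step function,
itself with derivative \<open>hat\<close>, the difference of two ramps. All sums over integer translates
then telescope.\<close>

definition ramp :: "real \<Rightarrow> real" where
  "ramp t = max 0 t - max 0 (t - 1)"

definition hat :: "real \<Rightarrow> real" where
  "hat t = ramp t - ramp (t - 1)"

definition smooth_step :: "real \<Rightarrow> real" where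
  "smooth_step t = ((max 0 t)\<^sup>2 - 2 * (max 0 (t - 1))\<^sup>2 + (max 0 (t - 2))\<^sup>2) / 2"

definition bspline :: "real \<Rightarrow> real" where
  "bspline t = smooth_step t - smooth_step (t - 1)"

definition bspline' :: "real \<Rightarrow> real" where
  "bspline' t = hat t - hat (t - 1)"

lemma DERIV_pos_square: "((\<lambda>t::real. (max 0 t)\<^sup>2) has_real_derivative 2 * max 0 t) (at t)"
proof -
  consider "t < 0" | "t = 0" | "t > 0" by linarith
  then show ?thesis
  proof cases
    case 1
    have "((\<lambda>t::real. 0) has_real_derivative 2 * max 0 t) (at t)" using 1 by simp
    then show ?thesis
      by (rule has_field_derivative_transform_within_open[where S = "{..<0}"]) (use 1 in auto)
  next
    case 3
    have "((\<lambda>t::real. t\<^sup>2) has_real_derivative 2 * max 0 t) (at t)"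
      using 3 DERIV_pow[of 2 t] by simp
    then show ?thesis
      by (rule has_field_derivative_transform_within_open[where S = "{0<..}"]) (use 3 in auto)
  next
    case 2
    (* the difference quotient of the truncated square at 0 is the truncation itself *)
    have 1: "((\<lambda>s::real. max 0 s) \<longlongrightarrow> max 0 0) (at 0)" by (intro tendsto_intros)
    have 2: "\<forall>\<^sub>F s in at (0::real). max 0 s = ((max 0 s)\<^sup>2 - (max 0 0)\<^sup>2) / (s - 0)"
      by (rule eventually_at_filter[THEN iffD2], rule always_eventually) (auto simp: max_def power2_eq_square)
    show ?thesis using Lim_transform_eventually[OF 1 2] \<open>t = 0\<close> by (simp add: has_field_derivative_iff)
  qed
qed

lemma DERIV_smooth_step: "(smooth_step has_real_derivative hat t) (at t)"
proof -
  have d: "((\<lambda>t. (max 0 (t - c))\<^sup>2) has_real_derivative 2 * max 0 (t - c)) (at t)" for c :: real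
  proof -
    have "((\<lambda>t. t - c) has_real_derivative 1) (at t)" by (auto intro!: derivative_eq_intros)
    from DERIV_chain2[OF DERIV_pos_square this] show ?thesis by simp
  qed
  have "(smooth_step has_real_derivative
      (2 * max 0 (t - 0) - 2 * (2 * max 0 (t - 1)) + 2 * max 0 (t - 2)) / 2) (at t)"
    unfolding smooth_step_def[abs_def] using d[of 0]
    by (intro DERIV_cdivide DERIV_add DERIV_diff DERIV_cmult d) simp
  moreover have "(2 * max 0 (t - 0) - 2 * (2 * max 0 (t - 1)) + 2 * max 0 (t - 2)) / 2 = hat t"
    by (simp add: hat_def ramp_def)
  ultimately show ?thesis by (simp only:)
qed

lemma DERIV_bspline: "(bspline has_real_derivative bspline' t) (at t)"
proof -
  have "((\<lambda>t. t - 1) has_real_derivative 1) (at t)" by (auto intro!: derivative_eq_intros)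
  from DERIV_diff[OF DERIV_smooth_step DERIV_chain2[OF DERIV_smooth_step this]]
  show ?thesis unfolding bspline_def[abs_def] bspline'_def by simp
qed

lemma continuous_bspline': "continuous_on UNIV bspline'"
  unfolding bspline'_def[abs_def] hat_def ramp_def by (intro continuous_intros)

lemma hat_nonneg: "0 \<le> hat t"
  unfolding hat_def ramp_def by linarith

lemma bspline_nonneg: "0 \<le> bspline t"
proof -
  have "smooth_step (t - 1) \<le> smooth_step t"
  proof (rule DERIV_nonneg_imp_nondecreasing[where f = smooth_step])
    fix s
    show "\<exists>y. (smooth_step has_real_derivative y) (at s) \<and> 0 \<le> y"
      using DERIV_smooth_step hat_nonneg by blast
  qed simp
  then show ?thesis by (simp add: bspline_def)
qed

lemma smooth_step_eq: "t \<le> 0 \<Longrightarrow> smooth_step t = 0" "2 \<le> t \<Longrightarrow> smooth_step t = 1"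
  by (auto simp: smooth_step_def power2_eq_square algebra_simps)

lemma bspline_support:
  assumes "t < 0 \<or> 3 < t"
  shows "bspline t = 0" "bspline' t = 0"
proof -
  show "bspline t = 0" using assms by (auto simp: bspline_def smooth_step_eq)
  show "bspline' t = 0" using assms by (auto simp: bspline'_def hat_def ramp_def)
qed

lemma sum_int_telescope:
  fixes F :: "real \<Rightarrow> real"
  shows "(\<Sum>k\<in>{- int M..int M}. F (t - of_int k) - F (t - of_int k - 1)) = F (t + real M) - F (t - real M - 1)"
proof (induction M)
  case (Suc M)
  have "{- int (Suc M)..int (Suc M)} = insert (- int (Suc M)) (insert (int (Suc M)) {- int M..int M})" by auto
  then have "(\<Sum>k\<in>{- int (Suc M)..int (Suc M)}. F (t - of_int k) - F (t - of_int k - 1))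
     = (F (t + real (Suc M)) - F (t + real (Suc M) - 1)) + ((F (t - real (Suc M)) - F (t - real (Suc M) - 1))
       + (\<Sum>k\<in>{- int M..int M}. F (t - of_int k) - F (t - of_int k - 1)))"
    by (simp add: algebra_simps)
  then show ?case unfolding Suc by (simp add: algebra_simps)
qed simp

context
  fixes t :: real and M :: nat
  assumes M: "\<bar>t\<bar> + 2 \<le> real M"
begin

lemma sum_bspline: "(\<Sum>k\<in>{- int M..int M}. bspline (t - of_int k)) = 1"
  unfolding bspline_def sum_int_telescope using M by (simp add: smooth_step_eq)

lemma sum_bspline': "(\<Sum>k\<in>{- int M..int M}. bspline' (t - of_int k)) = 0"
  unfolding bspline'_def sum_int_telescope using M by (auto simp: hat_def ramp_def)

lemma sum_abs_bspline': "(\<Sum>k\<in>{- int M..int M}. \<bar>bspline' (t - of_int k)\<bar>) \<le> 2"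
proof -
  have "(\<Sum>k\<in>{- int M..int M}. \<bar>bspline' (t - of_int k)\<bar>)
      \<le> (\<Sum>k\<in>{- int M..int M}. hat (t - of_int k) + hat (t - 1 - of_int k))"
  proof (rule sum_mono)
    fix k
    show "\<bar>bspline' (t - of_int k)\<bar> \<le> hat (t - of_int k) + hat (t - 1 - of_int k)"
      using hat_nonneg[of "t - of_int k"] hat_nonneg[of "t - 1 - of_int k"]
      by (simp add: bspline'_def algebra_simps)
  qed
  also have "\<dots> = 2"
    unfolding sum.distrib hat_def sum_int_telescope using M by (auto simp: ramp_def)
  finally show ?thesis .
qed

end

definition grid :: "nat \<Rightarrow> ('a::euclidean_space \<Rightarrow> int) set" where
  "grid M = PiE Basis (\<lambda>_. {- int M..int M})"

definition grid_bump :: "real \<Rightarrow> ('a \<Rightarrow> int) \<Rightarrow> 'a::euclidean_space \<Rightarrow> real" where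
  "grid_bump h k x = (\<Prod>i\<in>Basis. bspline ((x \<bullet> i) / h - of_int (k i)))"

text \<open>The partial derivative of the tensor product bump in the direction \<open>i\<close>, without
the factor \<open>1 / h\<close>.\<close>

definition grid_bump_slope :: "real \<Rightarrow> ('a \<Rightarrow> int) \<Rightarrow> 'a \<Rightarrow> 'a::euclidean_space \<Rightarrow> real" where
  "grid_bump_slope h k i x = (\<Prod>j\<in>Basis - {i}. bspline ((x \<bullet> j) / h - of_int (k j))) * bspline' ((x \<bullet> i) / h - of_int (k i))"

definition grid_bump_gradient :: "real \<Rightarrow> ('a \<Rightarrow> int) \<Rightarrow> 'a::euclidean_space \<Rightarrow> 'a" where
  "grid_bump_gradient h k x = (\<Sum>i\<in>Basis. (grid_bump_slope h k i x / h) *\<^sub>R i)"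

lemma grid_bump_mem: "(\<lambda>x. (grid_bump h k x, grid_bump_gradient h k x)) \<in> exp_jets"
proof -
  have "(\<lambda>x. (bspline ((x \<bullet> i) / h - of_int (k i)), (bspline' ((x \<bullet> i) / h - of_int (k i)) / h) *\<^sub>R i)) \<in> exp_jets" for i :: 'a
    using exp_jets_ridge[OF DERIV_bspline continuous_bspline', of "i /\<^sub>R h" "- of_int (k i)"]
    by (simp add: ridge_jet_def[abs_def] inner_commute divide_inverse mult.commute)
  from exp_jets_prod[OF finite_Basis this]
  show ?thesis by (simp add: grid_bump_def grid_bump_gradient_def grid_bump_slope_def[abs_def])
qed

lemma grid_bump_eq_0:
  assumes "i \<in> Basis" "(x \<bullet> i) / h - of_int (k i) < 0 \<or> 3 < (x \<bullet> i) / h - of_int (k i)"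
  shows "grid_bump h k x = 0" "j \<in> Basis \<Longrightarrow> grid_bump_slope h k j x = 0"
proof -
  note z = bspline_support[OF assms(2)]
  show "grid_bump h k x = 0"
    unfolding grid_bump_def using z(1) assms(1) by (intro prod_zero) auto
  assume j: "j \<in> Basis"
  show "grid_bump_slope h k j x = 0"
  proof (cases "i = j")
    case True
    then show ?thesis unfolding grid_bump_slope_def using z by simp
  next
    case False
    then have "(\<Prod>j\<in>Basis - {j}. bspline ((x \<bullet> j) / h - of_int (k j))) = 0"
      using z(1) assms(1) by (intro prod_zero) auto
    then show ?thesis unfolding grid_bump_slope_def by simp
  qed
qed

lemma grid_bump_nonneg: "0 \<le> grid_bump h k x"
  unfolding grid_bump_def by (intro prod_nonneg) (simp add: bspline_nonneg)

context
  fixes x :: "'a::euclidean_space" and h :: real and M :: nat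
  assumes M: "\<And>i. i \<in> Basis \<Longrightarrow> \<bar>(x \<bullet> i) / h\<bar> + 2 \<le> real M"
begin

lemma sum_grid_bump: "(\<Sum>k\<in>grid M. grid_bump h k x) = 1"
proof -
  have "(\<Sum>k\<in>grid M. grid_bump h k x) = (\<Prod>i\<in>Basis. \<Sum>m\<in>{- int M..int M}. bspline ((x \<bullet> i) / h - of_int m))"
    unfolding grid_bump_def grid_def by (rule prod_sum_PiE[symmetric]) auto
  also have "\<dots> = 1" by (intro prod.neutral ballI sum_bspline M)
  finally show ?thesis .
qed

text \<open>Sums over the grid of products of univariate factors are products of univariate sums; every
factor other than the one for \<open>i\<close> is one.\<close>

lemma sum_grid_bump_slope:
  assumes i: "i \<in> Basis"
  shows "(\<Sum>k\<in>grid M. grid_bump_slope h k i x) = 0"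
    and "(\<Sum>k\<in>grid M. \<bar>grid_bump_slope h k i x\<bar>) \<le> 2"
proof -
  have split: "(\<Sum>k\<in>grid M. (\<Prod>j\<in>Basis - {i}. bspline ((x \<bullet> j) / h - of_int (k j))) * u ((x \<bullet> i) / h - of_int (k i)))
     = (\<Sum>m\<in>{- int M..int M}. u ((x \<bullet> i) / h - of_int m))" for u :: "real \<Rightarrow> real"
  proof -
    define f where "f j m = (if j = i then u else bspline) ((x \<bullet> j) / h - of_int m)" for j :: 'a and m :: int
    have "(\<Sum>k\<in>grid M. (\<Prod>j\<in>Basis - {i}. bspline ((x \<bullet> j) / h - of_int (k j))) * u ((x \<bullet> i) / h - of_int (k i)))
      = (\<Sum>k\<in>grid M. \<Prod>j\<in>Basis. f j (k j))"
      using i by (intro sum.cong refl) (simp add: prod.remove[of Basis i] f_def mult.commute)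
    also have "\<dots> = (\<Prod>j\<in>Basis. \<Sum>m\<in>{- int M..int M}. f j m)"
      unfolding grid_def by (subst prod_sum_PiE) auto
    also have "\<dots> = (\<Sum>m\<in>{- int M..int M}. f i m) * (\<Prod>j\<in>Basis - {i}. \<Sum>m\<in>{- int M..int M}. f j m)"
      using i by (simp add: prod.remove[of Basis i])
    also have "(\<Prod>j\<in>Basis - {i}. \<Sum>m\<in>{- int M..int M}. f j m) = 1"
    proof (intro prod.neutral ballI)
      fix j assume "j \<in> Basis - {i}"
      then show "(\<Sum>m\<in>{- int M..int M}. f j m) = 1" using sum_bspline[OF M, of j] by (simp add: f_def)
    qed
    finally show ?thesis by (simp add: f_def)
  qed
  show "(\<Sum>k\<in>grid M. grid_bump_slope h k i x) = 0"
    unfolding grid_bump_slope_def split using M[OF i] by (rule sum_bspline')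
  have "\<bar>grid_bump_slope h k i x\<bar> = (\<Prod>j\<in>Basis - {i}. bspline ((x \<bullet> j) / h - of_int (k j))) * \<bar>bspline' ((x \<bullet> i) / h - of_int (k i))\<bar>" for k
    unfolding grid_bump_slope_def abs_mult by (simp add: prod_nonneg bspline_nonneg)
  then show "(\<Sum>k\<in>grid M. \<bar>grid_bump_slope h k i x\<bar>) \<le> 2"
    using split[of "\<lambda>t. \<bar>bspline' t\<bar>"] sum_abs_bspline'[OF M[OF i]] by simp
qed

lemma sum_grid_bump_gradient: "(\<Sum>k\<in>grid M. grid_bump_gradient h k x) = 0"
proof -
  have "(\<Sum>k\<in>grid M. grid_bump_gradient h k x) = (\<Sum>i\<in>Basis. \<Sum>k\<in>grid M. (grid_bump_slope h k i x / h) *\<^sub>R i)"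
    unfolding grid_bump_gradient_def by (rule sum.swap)
  also have "\<dots> = 0"
    by (intro sum.neutral) (auto simp: sum_grid_bump_slope simp flip: scaleR_sum_left sum_divide_distrib)
  finally show ?thesis .
qed

end

text \<open>The gradient of the glued function \<open>\<Sum>k. (V (y k) + g (y k) \<bullet> (x - y k)) *
grid_bump h k x\<close> has two parts. One is an average of the values \<open>g (y k)\<close> at nodes
near \<open>x\<close>. In the other \<open>V x\<close> may be subtracted from the affine functions, as
the bump gradients sum to zero; what remains is at most \<open>c * dist (y k) x\<close>, of order
\<open>c * h\<close>, times slopes of order \<open>1 / h\<close>.\<close>

theorem (in compact_differential) exp_jets_approximate_gradient:
  assumes "\<epsilon> > 0"
  shows "\<exists>F\<in>exp_jets. \<forall>x\<in>K. norm (snd (F x) - g x) \<le> \<epsilon>"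
proof -
  define D where "D = real DIM('a)"
  have D: "D \<ge> 1" unfolding D_def using DIM_positive[where 'a = 'a] by linarith
  (* the second part of the gradient is at most 6 * c * D^2 *)
  define c where "c = \<epsilon> / (12 * D\<^sup>2)"
  have c: "c > 0" using assms D by (simp add: c_def)
  obtain V :: "'a \<Rightarrow> real" and \<delta> where V: "\<delta> > 0"
    "\<And>x y. x \<in> K \<Longrightarrow> y \<in> K \<Longrightarrow> dist x y \<le> \<delta> \<Longrightarrow> \<bar>V y - V x - (y - x) \<bullet> g x\<bar> \<le> c * dist x y"
    using uniform_potential[OF c] by blast
  obtain \<delta>' where \<delta>': "\<delta>' > 0" "\<And>x y. x \<in> K \<Longrightarrow> y \<in> K \<Longrightarrow> dist y x < \<delta>' \<Longrightarrow> dist (g y) (g x) < \<epsilon> / 2"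
    using uniformly_continuous_onE[OF compact_uniformly_continuous[OF cont_g compact_K] half_gt_zero[OF assms]] by metis
  define h where "h = min \<delta> (\<delta>' / 2) / (3 * D)"
  have h: "h > 0" "3 * h * D \<le> \<delta>" "3 * h * D < \<delta>'"
    using V(1) \<delta>'(1) D by (auto simp: h_def)
  obtain R where R: "\<And>x. x \<in> K \<Longrightarrow> norm x \<le> R"
    using compact_imp_bounded[OF compact_K] unfolding bounded_iff by blast
  obtain M :: nat where M: "R / h + 2 \<le> real M" using real_arch_simple by blast
  have Mx: "\<bar>(x \<bullet> i) / h\<bar> + 2 \<le> real M" if "x \<in> K" "i \<in> Basis" for x i
  proof -
    have "\<bar>x \<bullet> i\<bar> \<le> R" using Basis_le_norm[OF that(2), of x] R[OF that(1)] by linarith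
    then have "\<bar>(x \<bullet> i) / h\<bar> \<le> R / h" using h(1) by (simp add: divide_right_mono)
    with M show ?thesis by linarith
  qed
  (* points of K in the support of the bump k; if there are none, the bump vanishes on K and y k is irrelevant *)
  define box where "box k = {x \<in> K. \<forall>i\<in>Basis. 0 \<le> (x \<bullet> i) / h - of_int (k i) \<and> (x \<bullet> i) / h - of_int (k i) \<le> 3}" for k
  define y where "y k = (SOME y. y \<in> box k)" for k
  have y: "y k \<in> K" "dist (y k) x \<le> 3 * h * D" if "x \<in> box k" for x k
  proof -
    have yk: "y k \<in> box k" unfolding y_def using that by (rule someI)
    then show "y k \<in> K" by (simp add: box_def)
    have "\<bar>(y k - x) \<bullet> i\<bar> \<le> 3 * h" if i: "i \<in> Basis" for i
    proof -
      have "\<bar>(y k \<bullet> i) / h - (x \<bullet> i) / h\<bar> \<le> 3" using yk \<open>x \<in> box k\<close> i by (force simp: box_def)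
      then have "\<bar>(y k - x) \<bullet> i\<bar> / h \<le> 3"
        using h(1) by (simp add: inner_diff_left flip: diff_divide_distrib)
      then show ?thesis using h(1) by (simp add: field_simps)
    qed
    then have "(\<Sum>i\<in>Basis. \<bar>(y k - x) \<bullet> i\<bar>) \<le> (\<Sum>i\<in>(Basis :: 'a set). 3 * h)" by (intro sum_mono) auto
    then show "dist (y k) x \<le> 3 * h * D" using norm_le_l1[of "y k - x"] by (simp add: dist_norm D_def ac_simps)
  qed
  define F where "F x = (\<Sum>k\<in>grid M. jet_times (ridge_jet (\<lambda>t. (t, 1)) (g (y k)) (V (y k) - g (y k) \<bullet> y k) x)
      (grid_bump h k x, grid_bump_gradient h k x))" for x
  have "F \<in> exp_jets"
    unfolding F_def[abs_def]
    by (intro exp_jets.sum exp_jets_times grid_bump_mem exp_jets_ridge) (auto intro!: derivative_eq_intros)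
  moreover have "norm (snd (F x) - g x) \<le> \<epsilon>" if x: "x \<in> K" for x
  proof -
    define e where "e k = g (y k) \<bullet> x + (V (y k) - g (y k) \<bullet> y k) - V x" for k
    have "snd (F x) = (\<Sum>k\<in>grid M. (e k + V x) *\<^sub>R grid_bump_gradient h k x + grid_bump h k x *\<^sub>R g (y k))"
      by (simp add: F_def snd_sum jet_times_def ridge_jet_def e_def)
    moreover have "V x *\<^sub>R (\<Sum>k\<in>grid M. grid_bump_gradient h k x) = 0"
      using sum_grid_bump_gradient[OF Mx[OF x]] by simp
    moreover have "(\<Sum>k\<in>grid M. grid_bump h k x) *\<^sub>R g x = g x"
      using sum_grid_bump[OF Mx[OF x]] by simp
    ultimately have "snd (F x) - g x = (\<Sum>k\<in>grid M. e k *\<^sub>R grid_bump_gradient h k x + grid_bump h k x *\<^sub>R (g (y k) - g x))"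
      by (simp add: sum.distrib sum_subtractf scaleR_left_distrib scaleR_right_diff_distrib scaleR_sum_left scaleR_sum_right)
    also have "norm \<dots> \<le> (\<Sum>k\<in>grid M. (\<Sum>i\<in>Basis. 3 * c * D * \<bar>grid_bump_slope h k i x\<bar>) + grid_bump h k x * (\<epsilon> / 2))"
    proof (rule sum_norm_le)
      fix k
      show "norm (e k *\<^sub>R grid_bump_gradient h k x + grid_bump h k x *\<^sub>R (g (y k) - g x))
         \<le> (\<Sum>i\<in>Basis. 3 * c * D * \<bar>grid_bump_slope h k i x\<bar>) + grid_bump h k x * (\<epsilon> / 2)"
      proof (cases "x \<in> box k")
        case False
        then obtain i where i: "i \<in> Basis" "(x \<bullet> i) / h - of_int (k i) < 0 \<or> 3 < (x \<bullet> i) / h - of_int (k i)"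
          using x unfolding box_def by force
        show ?thesis
          using grid_bump_eq_0[where k = k and x = x and h = h, OF i] by (simp add: grid_bump_gradient_def)
      next
        case True
        note yk = y[OF True]
        have "\<bar>V x - V (y k) - (x - y k) \<bullet> g (y k)\<bar> \<le> c * dist (y k) x"
          using V(2)[OF yk(1) x] yk(2) h(2) by simp
        also have "\<dots> \<le> c * (3 * h * D)" using yk(2) c by (intro mult_left_mono) auto
        also have "\<bar>V x - V (y k) - (x - y k) \<bullet> g (y k)\<bar> = \<bar>e k\<bar>"
        proof -
          have "V x - V (y k) - (x - y k) \<bullet> g (y k) = - e k"
            unfolding e_def inner_commute[of "g (y k)"] inner_diff_left by simp
          then show ?thesis by simp
        qed
        finally have ek: "\<bar>e k\<bar> \<le> 3 * c * D * h" by (simp add: ac_simps)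
        have "norm (e k *\<^sub>R grid_bump_gradient h k x) = norm (\<Sum>i\<in>Basis. (e k * (grid_bump_slope h k i x / h)) *\<^sub>R i)"
          by (simp add: grid_bump_gradient_def scaleR_sum_right)
        also have "\<dots> \<le> (\<Sum>i\<in>(Basis :: 'a set). 3 * c * D * \<bar>grid_bump_slope h k i x\<bar>)"
        proof (rule sum_norm_le)
          fix i :: 'a assume i: "i \<in> Basis"
          have "norm ((e k * (grid_bump_slope h k i x / h)) *\<^sub>R i) = \<bar>e k\<bar> * (\<bar>grid_bump_slope h k i x\<bar> / h)"
            using i h(1) by (simp add: abs_mult)
          also have "\<dots> \<le> (3 * c * D * h) * (\<bar>grid_bump_slope h k i x\<bar> / h)"
            using ek h(1) by (intro mult_right_mono) auto
          also have "\<dots> = 3 * c * D * \<bar>grid_bump_slope h k i x\<bar>" using h(1) by simp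
          finally show "norm ((e k * (grid_bump_slope h k i x / h)) *\<^sub>R i) \<le> 3 * c * D * \<bar>grid_bump_slope h k i x\<bar>" .
        qed
        finally have 1: "norm (e k *\<^sub>R grid_bump_gradient h k x) \<le> (\<Sum>i\<in>Basis. 3 * c * D * \<bar>grid_bump_slope h k i x\<bar>)" .
        have osc: "norm (g (y k) - g x) \<le> \<epsilon> / 2"
          using \<delta>'(2)[OF x yk(1)] yk(2) h(3) by (simp add: dist_norm)
        have 2: "norm (grid_bump h k x *\<^sub>R (g (y k) - g x)) \<le> grid_bump h k x * (\<epsilon> / 2)"
          using mult_left_mono[OF osc grid_bump_nonneg[of h k x]]
          by (simp only: norm_scaleR real_norm_def abs_of_nonneg[OF grid_bump_nonneg[of h k x]])
        show ?thesis using norm_triangle_le[OF add_mono[OF 1 2]] .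
      qed
    qed
    also have "\<dots> = (\<Sum>i\<in>Basis. 3 * c * D * (\<Sum>k\<in>grid M. \<bar>grid_bump_slope h k i x\<bar>)) + \<epsilon> / 2"
    proof -
      have "(\<Sum>k\<in>grid M. \<Sum>i\<in>Basis. 3 * c * D * \<bar>grid_bump_slope h k i x\<bar>)
          = (\<Sum>i\<in>Basis. 3 * c * D * (\<Sum>k\<in>grid M. \<bar>grid_bump_slope h k i x\<bar>))"
        by (subst sum.swap) (simp add: sum_distrib_left)
      moreover have "(\<Sum>k\<in>grid M. grid_bump h k x * (\<epsilon> / 2)) = \<epsilon> / 2"
        using sum_grid_bump[OF Mx[OF x]] unfolding sum_distrib_right[symmetric] by simp
      ultimately show ?thesis by (simp add: sum.distrib)
    qed
    also have "(\<Sum>i\<in>Basis. 3 * c * D * (\<Sum>k\<in>grid M. \<bar>grid_bump_slope h k i x\<bar>)) \<le> (\<Sum>i\<in>(Basis :: 'a set). 3 * c * D * 2)"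
      using sum_grid_bump_slope(2)[OF Mx[OF x]] c D by (intro sum_mono mult_left_mono) auto
    also have "(\<Sum>i\<in>(Basis :: 'a set). 3 * c * D * 2) = 6 * c * D\<^sup>2"
      by (simp add: D_def power2_eq_square)
    also have "6 * c * D\<^sup>2 + \<epsilon> / 2 = \<epsilon>" using D by (simp add: c_def)
    finally show ?thesis by simp
  qed
  ultimately show ?thesis by blast
qed

section \<open>Networks, smoothness and the mean square norm\<close>

lemma L2_of_uniform_bound:
  fixes f :: "'a::euclidean_space \<Rightarrow> 'b::euclidean_space"
  assumes K: "compact K" and f: "continuous_on K f" and le: "\<And>x. x \<in> K \<Longrightarrow> norm (f x) \<le> e" and "0 \<le> e"
  shows "in_L2 K f" and "L2_norm K f \<le> e * sqrt (measure lebesgue K)"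
proof -
  have Kb: "K \<in> sets borel" using K by (simp add: compact_imp_closed)
  have f2: "continuous_on K (\<lambda>x. (norm (f x))\<^sup>2)" by (intro continuous_intros f)
  have meas: "set_borel_measurable lebesgue K f"
    unfolding set_borel_measurable_def
    by (intro measurable_completion) (simp add: borel_measurable_continuous_on_indicator[OF Kb f])
  have int: "set_integrable lebesgue K h" if "continuous_on K h" for h :: "'a \<Rightarrow> real"
  proof -
    have "(\<lambda>x. indicat_real K x *\<^sub>R h x) \<in> borel_measurable lborel"
      using borel_measurable_continuous_on_indicator[OF Kb that] by simp
    then show ?thesis
      unfolding set_integrable_def using borel_integrable_compact[OF K that] by (simp add: integrable_completion)
  qed
  show "in_L2 K f" unfolding in_L2_def using meas int[OF f2] by blast
  have KL: "K \<in> sets lebesgue" "emeasure lebesgue K \<noteq> \<infinity>"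
    using lmeasurable_compact[OF K] by (auto simp: fmeasurable_def)
  have "(LINT x:K|lebesgue. (norm (f x))\<^sup>2) \<le> (LINT x:K|lebesgue. e\<^sup>2)"
    by (intro set_integral_mono int f2 power_mono le) auto
  also have "\<dots> = e\<^sup>2 * measure lebesgue K" using set_integral_const[OF KL, of "e\<^sup>2"] by simp
  finally have "L2_norm K f \<le> sqrt (e\<^sup>2 * measure lebesgue K)"
    unfolding L2_norm_def by simp
  also have "\<dots> = e * sqrt (measure lebesgue K)" using \<open>0 \<le> e\<close> by (simp add: real_sqrt_mult)
  finally show "L2_norm K f \<le> e * sqrt (measure lebesgue K)" .
qed

lemma gradient_eq:
  assumes "GDERIV f x :> D"
  shows "gradient f x = D"
proof -
  have "frechet_derivative f (at x) = (\<lambda>h. h \<bullet> D)"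
    using frechet_derivative_at assms unfolding gderiv_def by metis
  then show ?thesis by (simp add: gradient_def vec_eq_iff inner_axis')
qed

lemma bounded_energy_of_S12:
  assumes "\<sigma> \<in> S12"
  shows "bounded_energy \<sigma>"
proof -
  have c: "continuous_on UNIV \<sigma>"
    using assms C1_diff_imp_diff differentiable_imp_continuous_on unfolding S12_def by blast
  have abs: "(\<lambda>x. (norm (\<sigma> x))\<^sup>2) absolutely_integrable_on UNIV"
    using assms unfolding S12_def in_L2_def by blast
  then have int: "(\<lambda>x. (norm (\<sigma> x))\<^sup>2) integrable_on UNIV"
    by (simp add: absolutely_integrable_on_def)
  have "integral {a..b} (\<lambda>t. (\<sigma> t)\<^sup>2) \<le> integral UNIV (\<lambda>t. (\<sigma> t)\<^sup>2)" for a b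
    using int by (intro integral_subset_le integrable_continuous_interval continuous_intros continuous_on_subset[OF c]) auto
  then show ?thesis unfolding bounded_energy_def using c by blast
qed

lemma network_of_span:
  fixes p :: "real ^ 'n \<Rightarrow> real \<times> (real ^ 'n)"
  assumes \<sigma>: "\<And>t. (\<sigma> has_real_derivative \<sigma>' t) (at t)" "continuous_on UNIV \<sigma>'"
    and p: "p \<in> fspan {ridge_jet (\<lambda>t. (\<sigma> t, \<sigma>' t)) a b |a b. True}"
  shows "(\<lambda>x. fst (p x)) \<in> neural_networks \<sigma> \<and> (\<forall>x. GDERIV (\<lambda>x. fst (p x)) x :> snd (p x))
    \<and> continuous_on UNIV (\<lambda>x. snd (p x))"
  using p
proof (induction rule: fspan.induct)
  case fspan_zero
  have "(\<lambda>x. 0) \<in> neural_networks \<sigma>" unfolding neural_networks_def by (auto intro!: exI[of _ "0::nat"])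
  then show ?case by (simp add: GDERIV_const)
next
  case (fspan_step p r c)
  then obtain a b where r: "r = ridge_jet (\<lambda>t. (\<sigma> t, \<sigma>' t)) a b" by blast
  obtain q :: nat and \<beta> as bs where p: "(\<lambda>x. fst (p x)) = (\<lambda>x. \<Sum>j<q. \<beta> j * \<sigma> (as j \<bullet> x + bs j))"
    using fspan_step.IH[THEN conjunct1] unfolding neural_networks_def mem_Collect_eq by blast
  have "fst (p x + c *\<^sub>R r x) = (\<Sum>j<Suc q. (\<beta>(q := c)) j * \<sigma> ((as(q := a)) j \<bullet> x + (bs(q := b)) j))" for x
    using fun_cong[OF p, of x] by (simp add: r ridge_jet_def)
  then have "(\<lambda>x. fst (p x + c *\<^sub>R r x)) \<in> neural_networks \<sigma>"
    unfolding neural_networks_def by blast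
  moreover have "GDERIV (\<lambda>x. fst (p x + c *\<^sub>R r x)) x :> snd (p x + c *\<^sub>R r x)" for x
  proof -
    have "GDERIV (\<lambda>x. a \<bullet> x + b) x :> a"
      unfolding gderiv_def by (auto intro!: derivative_eq_intros simp: inner_commute)
    from GDERIV_DERIV_compose[OF this \<sigma>(1)]
    have "GDERIV (\<lambda>x. \<sigma> (a \<bullet> x + b)) x :> \<sigma>' (a \<bullet> x + b) *\<^sub>R a" .
    from GDERIV_mult[OF GDERIV_const[of c x] this]
    have "GDERIV (\<lambda>x. c * \<sigma> (a \<bullet> x + b)) x :> c *\<^sub>R \<sigma>' (a \<bullet> x + b) *\<^sub>R a" by simp
    from GDERIV_add[OF _ this, of "\<lambda>x. fst (p x)" "snd (p x)"] fspan_step.IH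
    show ?thesis by (simp add: r ridge_jet_def)
  qed
  moreover have "continuous_on UNIV (\<lambda>x. snd (p x + c *\<^sub>R r x))"
    using fspan_step.IH unfolding r ridge_jet_def
    by (auto intro!: continuous_intros continuous_on_compose2[OF \<sigma>(2)])
  ultimately show ?case by blast
qed

text \<open>A directional derivative of a ridge function is a multiple of the ridge function of
\<open>\<sigma>'\<close>, so the induction runs over all \<open>\<sigma>\<close> and all factors
\<open>c\<close>.\<close>

lemma C_k_ridge:
  fixes a :: "'a::euclidean_space"
  assumes "C_k k \<sigma>"
  shows "C_k k (\<lambda>x. c * \<sigma> (a \<bullet> x + b) :: real)"
  using assms
proof (induction k arbitrary: \<sigma> c)
  case 0
  then have c: "continuous_on UNIV \<sigma>" by simp
  have "continuous_on UNIV (\<lambda>x. c * \<sigma> (a \<bullet> x + b))"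
    by (intro continuous_intros continuous_on_compose2[OF c]) auto
  then show ?case by simp
next
  case (Suc k)
  define \<tau> where "\<tau> s = frechet_derivative \<sigma> (at s) 1" for s
  have "C_k k \<tau>" using Suc.prems by (simp add: \<tau>_def[abs_def])
  have d\<sigma>: "(\<sigma> has_derivative frechet_derivative \<sigma> (at s)) (at s)" for s
    using Suc.prems by (simp add: frechet_derivative_works)
  then have \<tau>: "frechet_derivative \<sigma> (at s) v = v * \<tau> s" for s v
    using linear_cmul[OF has_derivative_linear, of \<sigma> "frechet_derivative \<sigma> (at s)" "at s" v 1]
    by (simp add: \<tau>_def)
  have d: "((\<lambda>x. c * \<sigma> (a \<bullet> x + b)) has_derivative (\<lambda>v. c * (a \<bullet> v) * \<tau> (a \<bullet> x + b))) (at x)" for x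
  proof -
    have "((\<lambda>x. a \<bullet> x + b) has_derivative (\<lambda>v. a \<bullet> v)) (at x)" by (auto intro!: derivative_eq_intros)
    from has_derivative_mult_right[OF has_derivative_compose[OF this d\<sigma>], of c]
    show ?thesis by (simp add: \<tau> mult.assoc)
  qed
  then have "frechet_derivative (\<lambda>x. c * \<sigma> (a \<bullet> x + b)) (at x) v = c * (a \<bullet> v) * \<tau> (a \<bullet> x + b)" for x v
    using frechet_derivative_at[OF d, of x] by metis
  moreover have "(\<lambda>x. c * \<sigma> (a \<bullet> x + b)) differentiable (at x)" for x
    using d differentiable_def by blast
  ultimately show ?case using Suc.IH[OF \<open>C_k k \<tau>\<close>] by simp
qed

lemma C_k_const: "C_k k (\<lambda>_. c)"
  by (induction k arbitrary: c) auto

lemma C_k_add: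
  assumes "C_k k f" "C_k k h"
  shows "C_k k (\<lambda>x. f x + h x)"
  using assms
proof (induction k arbitrary: f h)
  case (Suc k)
  then have fh: "f differentiable (at x)" "h differentiable (at x)" for x by auto
  have "frechet_derivative (\<lambda>x. f x + h x) (at x)
      = (\<lambda>v. frechet_derivative f (at x) v + frechet_derivative h (at x) v)" for x
    using has_derivative_add[OF fh(1)[unfolded frechet_derivative_works] fh(2)[unfolded frechet_derivative_works]]
    by (rule frechet_derivative_at[symmetric])
  with Suc fh show ?case by simp
qed (auto intro: continuous_intros)

lemma C_infinity_network:
  assumes "C_infinity \<sigma>" "f \<in> neural_networks \<sigma>"
  shows "C_infinity f"
proof -
  obtain q \<beta> a b where f: "f = (\<lambda>x. \<Sum>j<(q::nat). \<beta> j * \<sigma> (a j \<bullet> x + b j))"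
    using assms(2) unfolding neural_networks_def by blast
  have "C_k k (\<lambda>x. \<Sum>j<q. \<beta> j * \<sigma> (a j \<bullet> x + b j))" for k
  proof (induction q)
    case (Suc q)
    have "C_k k \<sigma>" using assms(1) unfolding C_infinity_def by blast
    from C_k_add[OF Suc C_k_ridge[OF this, of "\<beta> q" "a q" "b q"]] show ?case by simp
  qed (simp add: C_k_const)
  then show ?thesis unfolding C_infinity_def f by blast
qed

text \<open>Half of the admissible error \<open>e\<close> is spent on approximating \<open>gradient
H\<close> by a member of \<open>exp_jets\<close>, half on approximating this member by a network.\<close>

theorem network_approximation:
  fixes H :: "real ^ 'n \<Rightarrow> real"
    and G :: "real ^ 'n ^ 'n"
  assumes H: "\<forall>u. H differentiable (at u)"
    and G: "invertible G"
    and K: "compact K"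
    and L: "\<exists>L. L-lipschitz_on K (energy_rhs G H)"
    and \<sigma>: "\<sigma> \<in> S12" "\<sigma> \<noteq> (\<lambda>_. 0)"
    and \<epsilon>: "\<epsilon> > 0"
  shows "\<exists>H_NN\<in>neural_networks \<sigma>. in_L2 K (\<lambda>u. energy_rhs G H u - energy_rhs G H_NN u)
    \<and> L2_norm K (\<lambda>u. energy_rhs G H u - energy_rhs G H_NN u) < \<epsilon>"
proof -
  have rhs: "continuous_on K (energy_rhs G H)" using L lipschitz_on_continuous_on by blast
  have lin: "bounded_linear ((*v) A)" for A :: "real ^ 'n ^ 'n" by simp
  obtain G' where G': "G' ** G = mat 1" using G unfolding invertible_def by blast
  have "(\<lambda>u. G' *v energy_rhs G H u) = gradient H"
    by (simp add: energy_rhs_def matrix_vector_mul_assoc G')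
  then have cont: "continuous_on K (gradient H)"
    using bounded_linear.continuous_on[OF lin rhs, of G'] by (simp only:)
  have dH: "(H has_derivative (\<lambda>h. h \<bullet> gradient H x)) (at x)" for x
    using GDERIV_gradient[OF spec[OF H]] unfolding gderiv_def .
  interpret compact_differential K H "gradient H"
    using K cont has_derivative_at_withinI[OF dH] by (rule compact_differential.intro)
  obtain \<sigma>' where "\<And>t. (\<sigma> has_vector_derivative \<sigma>' t) (at t)" and c\<sigma>: "continuous_on UNIV \<sigma>'"
    using \<sigma>(1) unfolding S12_def C1_differentiable_on_def by blast
  then have d\<sigma>: "(\<sigma> has_real_derivative \<sigma>' t) (at t)" for t
    by (simp add: has_real_derivative_iff_has_vector_derivative)
  define B :: "(real ^ 'n \<Rightarrow> real \<times> (real ^ 'n)) set" where "B = {ridge_jet (\<lambda>t. (\<sigma> t, \<sigma>' t)) a b |a b. True}"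
  have ridge: "ridge_jet (\<lambda>t. (\<sigma> t, \<sigma>' t)) a b \<in> lu_closure (fspan B)" for a b
  proof -
    have "ridge_jet (\<lambda>t. (\<sigma> t, \<sigma>' t)) a b \<in> B" unfolding B_def by blast
    then show ?thesis using fspan_base subset_lu_closure[of "fspan B"] by blast
  qed
  have sub: "exp_jets \<subseteq> lu_closure (fspan B)"
    using closed_function_space_lu_closure ridge d\<sigma> c\<sigma> bounded_energy_of_S12[OF \<sigma>(1)] \<sigma>(2)
    by (rule exp_jets_subset[where \<sigma> = \<sigma> and \<sigma>' = \<sigma>'])
  define C where "C = onorm ((*v) G) * sqrt (measure lebesgue K)"
  have C: "C \<ge> 0" unfolding C_def using onorm_pos_le[OF lin] by simp
  (* C may be zero, hence C + 1 *)
  define e where "e = \<epsilon> / (2 * (C + 1))"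
  have e: "e > 0" unfolding e_def using \<epsilon> C by simp
  obtain R where R: "\<And>x. x \<in> K \<Longrightarrow> norm x \<le> R"
    using compact_imp_bounded[OF K] unfolding bounded_iff by blast
  obtain F where F: "F \<in> exp_jets" "\<And>x. x \<in> K \<Longrightarrow> norm (snd (F x) - gradient H x) \<le> e / 2"
    using exp_jets_approximate_gradient[of "e / 2"] e by auto
  have "e / 2 > 0" using e by simp
  then obtain p where p: "p \<in> fspan B" "\<And>x. x \<in> cball 0 R \<Longrightarrow> norm (F x - p x) \<le> e / 2"
    using lu_closureD[OF subsetD[OF sub F(1)]] by blast
  define N where "N x = fst (p x)" for x
  have N: "N \<in> neural_networks \<sigma>" "\<And>x. GDERIV N x :> snd (p x)" "continuous_on UNIV (\<lambda>x. snd (p x))"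
    using network_of_span[OF d\<sigma> c\<sigma> p(1)[unfolded B_def]] unfolding N_def[abs_def] by blast+
  have gN: "gradient N x = snd (p x)" for x using gradient_eq[OF N(2)] .
  define f where "f u = energy_rhs G H u - energy_rhs G N u" for u
  have cf: "continuous_on K f"
    unfolding f_def[abs_def] energy_rhs_def[of G N] gN
    by (intro continuous_on_diff rhs bounded_linear.continuous_on[OF lin] continuous_on_subset[OF N(3)]) auto
  have "norm (f x) \<le> onorm ((*v) G) * e" if x: "x \<in> K" for x
  proof -
    have "norm (snd (F x) - snd (p x)) \<le> e / 2"
      using norm_fst_snd_le(2)[of "F x - p x"] p(2)[of x] R[OF x] by simp
    then have "norm (gradient H x - snd (p x)) \<le> e"
      using F(2)[OF x] norm_diff_triangle_le[of "gradient H x" "snd (F x)" "e / 2" "snd (p x)" "e / 2"]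
      by (simp add: norm_minus_commute)
    then have "onorm ((*v) G) * norm (gradient H x - snd (p x)) \<le> onorm ((*v) G) * e"
      using onorm_pos_le[OF lin] by (intro mult_left_mono)
    moreover have "f x = G *v (gradient H x - snd (p x))"
      by (simp add: f_def energy_rhs_def gN matrix_vector_mult_diff_distrib)
    ultimately show ?thesis using onorm[OF lin, of G "gradient H x - snd (p x)"] by simp
  qed
  note L2 = L2_of_uniform_bound[OF K cf this]
  have pos: "0 \<le> onorm ((*v) G) * e" using onorm_pos_le[OF lin] e by simp
  have "L2_norm K f \<le> onorm ((*v) G) * e * sqrt (measure lebesgue K)" using L2(2)[OF _ pos] by simp
  also have "\<dots> = C * e" by (simp add: C_def)
  also have "\<dots> < \<epsilon>"
  proof -
    have "C * e \<le> (C + 1) * e" using e by simp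
    also have "\<dots> = \<epsilon> / 2" unfolding e_def using C by (simp add: divide_simps)
    finally show ?thesis using \<epsilon> by simp
  qed
  finally have "L2_norm K f < \<epsilon>" .
  moreover have "in_L2 K f" using L2(1)[OF _ pos] by simp
  ultimately show ?thesis using N(1) unfolding f_def by blast
qed

theorem theorem12:
  fixes H :: "real ^ 'n \<Rightarrow> real"
    and G :: "real ^ 'n ^ 'n"
    and K :: "(real ^ 'n) set"
    and \<sigma> :: "real \<Rightarrow> real"
  assumes "\<forall>u. H differentiable (at u)"
    and "invertible G"
    and "compact K"
    and "\<exists>L. L-lipschitz_on K (energy_rhs G H)"
    and "\<sigma> \<in> S12"
    and "\<sigma> \<noteq> (\<lambda>_. 0)"
  shows "(\<forall>\<epsilon>>0. \<exists>H_NN \<in> neural_networks \<sigma>.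
            in_L2 K (\<lambda>u. energy_rhs G H u - energy_rhs G H_NN u) \<and>
            L2_norm K (\<lambda>u. energy_rhs G H u - energy_rhs G H_NN u) < \<epsilon>) \<and>
         (C_infinity H \<and> C_infinity \<sigma> \<longrightarrow>
           (\<forall>\<epsilon>>0. \<exists>H_NN \<in> neural_networks \<sigma>. C_infinity H_NN \<and>
              in_L2 K (\<lambda>u. energy_rhs G H u - energy_rhs G H_NN u) \<and>
              L2_norm K (\<lambda>u. energy_rhs G H u - energy_rhs G H_NN u) < \<epsilon>))"
  using network_approximation[OF assms] C_infinity_network by blast

end
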